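(* Let $\mathsf{M}$ be a connected matroid of rank $k$ and cardinality $n$, and assume that $A$ is a stressed subset of $\mathsf{M}$ with non-empty cover such that $\operatorname{rk}(A)=r$ and $|A|=h$. Consider the relaxed matroid $\widetilde{\mathsf{M}}=\operatorname{Rel}(\mathsf{M},A)$. Then there is a matroid subdivision of the base polytope $\mathscr{P}(\widetilde{\mathsf{M}})$ having exactly three internal faces, and these three faces are the base polytopes of matroids isomorphic to $\mathsf{M}$, $\mathsf{\Lambda}_{r,k,h,n}$ and $\mathsf{U}_{k-r,n-h}\oplus\mathsf{U}_{r,h}$, respectively.
   Context: $\mathsf{U}_{k,n}$ is the uniform matroid of rank $k$ on $n$ elements. Let $\mathsf{M}$ be a matroid on $E$ of rank $k$ with rank function $\operatorname{rk}$ and set of bases $\mathscr{B}$. A subset $A\subseteq E$ is stressed if both $\mathsf{M}|_A$ and $\mathsf{M}/A$ are uniform. The cover of $A$ is $\operatorname{cover}(A)=\{S\subseteq E: |S|=k,\ |S\cap A|\ge \operatorname{rk}(A)+1\}$. If $A$ is stressed, $\operatorname{Rel}(\mathsf{M},A)$ denotes the matroid on $E$ with set of bases $\mathscr{B}\sqcup\operatorname{cover}(A)$. For $0\le r\le h$ and $0\le k-r\le n-h$, $\mathsf{\Lambda}_{r,k,h,n}$ is the relaxation of $\mathsf{U}_{k-r,n-h}\oplus\mathsf{U}_{r,h}$ by the ground set $F$ of the summand $\mathsf{U}_{r,h}$; it has rank $k$ and $n$ elements, and its bases are the $k$-subsets $B$ of its ground set with $|B\cap F|\ge r$, where $|F|=h$.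 The base polytope of a matroid $\mathsf{M}$ on $E$ is $\mathscr{P}(\mathsf{M})=\operatorname{conv}\{e_B: B\in\mathscr{B}\}\subseteq\mathbb{R}^E$, where $e_B=\sum_{i\in B}e_i$. A matroid subdivision of a matroid polytope $\mathscr{P}\subseteq\mathbb{R}^E$ is a finite collection $\mathcal{S}$ of base polytopes of matroids on $E$ (together with the empty face) whose union is $\mathscr{P}$, which is closed under taking faces, and such that any two members intersect in a common (possibly empty) face of both. The internal (interior) faces of $\mathcal{S}$ are the members of $\mathcal{S}$ not contained in the relative boundary $\partial\mathscr{P}$. *)

theory Defs
  imports "HOL-Analysis.Analysis"
begin

text \<open>A ground set together with a family of sets; it is a matroid when it satisfies the
  predicate \<open>matroid\<close> below.\<close>

datatype 'a pre_matroid = Pre_Matroid (ground: "'a set") (bases: "'a set set")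

definition matroid :: "'a pre_matroid \<Rightarrow> bool" where
  "matroid M \<longleftrightarrow>
     finite (ground M) \<and> bases M \<noteq> {} \<and> (\<forall>B\<in>bases M. B \<subseteq> ground M) \<and>
     (\<forall>B1\<in>bases M. \<forall>B2\<in>bases M. \<forall>x\<in>B1 - B2. \<exists>y\<in>B2 - B1. insert y (B1 - {x}) \<in> bases M)"

definition indep :: "'a pre_matroid \<Rightarrow> 'a set \<Rightarrow> bool" where
  "indep M I \<longleftrightarrow> (\<exists>B\<in>bases M. I \<subseteq> B)"

definition circuit :: "'a pre_matroid \<Rightarrow> 'a set \<Rightarrow> bool" where
  "circuit M C \<longleftrightarrow> C \<subseteq> ground M \<and> \<not> indep M C \<and> (\<forall>D. D \<subset> C \<longrightarrow> indep M D)"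

definition connected_matroid :: "'a pre_matroid \<Rightarrow> bool" where
  "connected_matroid M \<longleftrightarrow>
     (\<forall>e\<in>ground M. \<forall>f\<in>ground M. e \<noteq> f \<longrightarrow> (\<exists>C. circuit M C \<and> e \<in> C \<and> f \<in> C))"

definition rk :: "'a pre_matroid \<Rightarrow> 'a set \<Rightarrow> nat" where
  "rk M X = Max {card I | I. indep M I \<and> I \<subseteq> X}"

definition matroid_rank :: "'a pre_matroid \<Rightarrow> nat" where
  "matroid_rank M = rk M (ground M)"

definition matroid_iso :: "'a pre_matroid \<Rightarrow> 'b pre_matroid \<Rightarrow> bool" where
  "matroid_iso M N \<longleftrightarrow>
     (\<exists>f. bij_betw f (ground M) (ground N) \<and>
          (\<forall>B. B \<subseteq> ground M \<longrightarrow> (B \<in> bases M \<longleftrightarrow> f ` B \<in> bases N)))"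

definition restriction :: "'a pre_matroid \<Rightarrow> 'a set \<Rightarrow> 'a pre_matroid" where
  "restriction M A =
     Pre_Matroid A {I. indep M I \<and> I \<subseteq> A \<and> (\<forall>J. indep M J \<and> I \<subseteq> J \<and> J \<subseteq> A \<longrightarrow> J = I)}"

text \<open>In a matroid, the choice of the basis \<open>I\<close> of \<open>M|A\<close> does not affect \<open>M/A\<close>.\<close>

definition contraction :: "'a pre_matroid \<Rightarrow> 'a set \<Rightarrow> 'a pre_matroid" where
  "contraction M A =
     Pre_Matroid (ground M - A)
       {S. S \<subseteq> ground M - A \<and> (\<exists>I\<in>bases (restriction M A). S \<union> I \<in> bases M)}"

text \<open>The uniform matroid of rank \<open>k\<close> on the set \<open>E\<close>; it is a matroid when \<open>k \<le> card E\<close>.\<close>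

definition uniform :: "nat \<Rightarrow> 'a set \<Rightarrow> 'a pre_matroid" where
  "uniform k E = Pre_Matroid E {B. B \<subseteq> E \<and> card B = k}"

definition is_uniform :: "'a pre_matroid \<Rightarrow> bool" where
  "is_uniform M \<longleftrightarrow> (\<exists>k\<le>card (ground M). M = uniform k (ground M))"

text \<open>The internal direct sum, to be used for matroids on disjoint ground sets.\<close>

definition direct_sum :: "'a pre_matroid \<Rightarrow> 'a pre_matroid \<Rightarrow> 'a pre_matroid" where
  "direct_sum M N =
     Pre_Matroid (ground M \<union> ground N) {B \<union> C | B C. B \<in> bases M \<and> C \<in> bases N}"

definition stressed :: "'a pre_matroid \<Rightarrow> 'a set \<Rightarrow> bool" where
  "stressed M A \<longleftrightarrow>
     A \<subseteq> ground M \<and> is_uniform (restriction M A) \<and> is_uniform (contraction M A)"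

definition cover :: "'a pre_matroid \<Rightarrow> 'a set \<Rightarrow> 'a set set" where
  "cover M A = {S. S \<subseteq> ground M \<and> card S = matroid_rank M \<and> card (S \<inter> A) \<ge> rk M A + 1}"

definition Rel :: "'a pre_matroid \<Rightarrow> 'a set \<Rightarrow> 'a pre_matroid" where
  "Rel M A = Pre_Matroid (ground M) (bases M \<union> cover M A)"

text \<open>A concrete copy of the direct sum of \<open>U\<^bsub>k-r,n-h\<^esub>\<close> and \<open>U\<^bsub>r,h\<^esub>\<close>
  on \<open>{0,\<dots>,n-1}\<close>, the summand \<open>U\<^bsub>r,h\<^esub>\<close> living on \<open>{0,\<dots>,h-1}\<close>.\<close>

definition uniform_sum :: "nat \<Rightarrow> nat \<Rightarrow> nat \<Rightarrow> nat \<Rightarrow> nat pre_matroid" where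
  "uniform_sum r k h n = direct_sum (uniform (k - r) {h..<n}) (uniform r {..<h})"

definition Lambda_matroid :: "nat \<Rightarrow> nat \<Rightarrow> nat \<Rightarrow> nat \<Rightarrow> nat pre_matroid" where
  "Lambda_matroid r k h n = Rel (uniform_sum r k h n) {..<h}"

text \<open>Ground sets are subsets \<open>E\<close> of a finite type \<open>'a\<close>, and \<open>\<real>\<^sup>E\<close> is the coordinate subspace
  of \<open>real ^ 'a\<close> spanned by \<open>E\<close>; for \<open>E = UNIV\<close> it is all of \<open>real ^ 'a\<close>. Convex hulls, faces
  and relative boundaries do not depend on the ambient space.\<close>

definition indicator_vec :: "'a::finite set \<Rightarrow> real ^ 'a" where
  "indicator_vec B = (\<Sum>i\<in>B. axis i 1)"

definition base_polytope :: "'a::finite pre_matroid \<Rightarrow> (real ^ 'a) set" where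
  "base_polytope M = convex hull (indicator_vec ` bases M)"

text \<open>Subdivisions of the base polytope of the matroid \<open>M\<close>. The library relation \<open>face_of\<close>
  counts the empty set as a face of every convex set.\<close>

definition matroid_subdivision :: "'a::finite pre_matroid \<Rightarrow> (real ^ 'a) set set \<Rightarrow> bool" where
  "matroid_subdivision M \<S> \<longleftrightarrow>
     matroid M \<and> finite \<S> \<and> {} \<in> \<S> \<and>
     (\<forall>Q\<in>\<S>. Q \<noteq> {} \<longrightarrow> (\<exists>N. matroid N \<and> ground N = ground M \<and> Q = base_polytope N)) \<and>
     \<Union>\<S> = base_polytope M \<and>
     (\<forall>Q\<in>\<S>. \<forall>F. F face_of Q \<longrightarrow> F \<in> \<S>) \<and>
     (\<forall>Q\<in>\<S>. \<forall>R\<in>\<S>. (Q \<inter> R) face_of Q \<and> (Q \<inter> R) face_of R)"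

definition internal_faces ::
    "'a::finite pre_matroid \<Rightarrow> (real ^ 'a) set set \<Rightarrow> (real ^ 'a) set set" where
  "internal_faces M \<S> = {Q\<in>\<S>. \<not> Q \<subseteq> rel_frontier (base_polytope M)}"

end

theory Submission
  imports Defs
begin

text \<open>Let \<open>r = rk M A\<close>. Every basis of \<open>M\<close> meets \<open>A\<close> in at most \<open>r\<close> elements, and as \<open>A\<close> is stressed,
  every \<open>k\<close>-set that meets \<open>A\<close> in exactly \<open>r\<close> elements is a basis. Cut the polytope of the
  relaxation by the hyperplane \<open>x(A) = r\<close>. The points of the cut have coordinates between 0 and 1
  and integral sums over \<open>A\<close> and over its complement, so they form a product of two
  hypersimplices, which is the polytope of the direct sum of the uniform matroids. Hence the two
  halves are the polytopes of \<open>M\<close> and of \<open>\<Lambda>\<close>, and the subdivision consists of all their faces.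
  Connectedness of \<open>M\<close> and non-emptiness of the cover say that the polytope has points strictly on
  both sides of the hyperplane; for any convex polytope cut in this way, a face of one of the
  halves that meets the relative interior of the whole is that half or the cut itself.\<close>

section \<open>Exchange and rank\<close>

lemma matroid_exchange:
  assumes "matroid M" "B1 \<in> bases M" "B2 \<in> bases M" "x \<in> B1 - B2"
  obtains y where "y \<in> B2 - B1" "insert y (B1 - {x}) \<in> bases M"
  using assms unfolding matroid_def by blast

lemma basis_subset_ground: "matroid M \<Longrightarrow> B \<in> bases M \<Longrightarrow> B \<subseteq> ground M"
  by (simp add: matroid_def)

lemma finite_basis: "matroid M \<Longrightarrow> B \<in> bases M \<Longrightarrow> finite B"
  by (metis matroid_def finite_subset)

lemma card_swap:
  "finite B \<Longrightarrow> x \<in> B \<Longrightarrow> y \<notin> B \<Longrightarrow> card (insert y (B - {x})) = card B"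
  by (simp add: card_Suc_Diff1 del: card_Diff_insert)

text \<open>Induction on the number of elements of \<open>B1\<close> outside \<open>B2\<close>: an
  exchange lowers it by one and keeps the size of \<open>B1\<close>, and once \<open>B1\<close> lies
  inside \<open>B2\<close> the claim is clear.\<close>

lemma card_basis_le:
  assumes "matroid M" "B1 \<in> bases M" "B2 \<in> bases M"
  shows "card B1 \<le> card B2"
  using assms(2)
proof (induction "card (B1 - B2)" arbitrary: B1 rule: less_induct)
  case less
  note fin = finite_basis[OF assms(1) less.prems]
  show ?case
  proof (cases "B1 \<subseteq> B2")
    case True
    then show ?thesis
      by (simp add: card_mono finite_basis[OF assms(1,3)])
  next
    case False
    then obtain x where x: "x \<in> B1 - B2" by blast
    obtain y where y: "y \<in> B2 - B1" "insert y (B1 - {x}) \<in> bases M"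
      using matroid_exchange[OF assms(1) less.prems assms(3) x] .
    have "insert y (B1 - {x}) - B2 = (B1 - B2) - {x}"
      using y by blast
    moreover have "card ((B1 - B2) - {x}) < card (B1 - B2)"
      using x fin by (meson card_Diff1_less finite_Diff)
    ultimately have "card (insert y (B1 - {x})) \<le> card B2"
      using less.hyps y(2) by simp
    moreover have "card (insert y (B1 - {x})) = card B1"
      using x y fin by (intro card_swap) auto
    ultimately show ?thesis by simp
  qed
qed

lemma card_basis_eq:
  assumes "matroid M" "B1 \<in> bases M" "B2 \<in> bases M"
  shows "card B1 = card B2"
  using card_basis_le assms by (metis le_antisym)

text \<open>Among the bases containing \<open>I\<close>, one with the fewest elements outside
  \<open>I \<union> B\<close> has none: exchanging such an element against \<open>B\<close> would
  give a smaller count while keeping \<open>I\<close>.\<close>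

lemma indep_extend:
  assumes "matroid M" "indep M I" "B \<in> bases M"
  obtains B' where "B' \<in> bases M" "I \<subseteq> B'" "B' \<subseteq> I \<union> B"
proof -
  define d where "d B' = card (B' - (I \<union> B))" for B'
  obtain B0 where "B0 \<in> bases M \<and> I \<subseteq> B0"
    using assms(2) by (auto simp: indep_def)
  then obtain B' where B': "B' \<in> bases M \<and> I \<subseteq> B'"
    and min: "\<And>B''. B'' \<in> bases M \<and> I \<subseteq> B'' \<Longrightarrow> d B' \<le> d B''"
    using ex_has_least_nat[of "\<lambda>B'. B' \<in> bases M \<and> I \<subseteq> B'" B0 d] by blast
  have "B' \<subseteq> I \<union> B"
  proof (rule ccontr)
    assume "\<not> ?thesis"
    then obtain x where x: "x \<in> B'" "x \<notin> I" "x \<notin> B" by blast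
    then obtain y where y: "y \<in> B - B'" "insert y (B' - {x}) \<in> bases M"
      using matroid_exchange[OF assms(1), of B' B x] B' assms(3) by blast
    have "insert y (B' - {x}) - (I \<union> B) = (B' - (I \<union> B)) - {x}"
      using y by blast
    then have "d (insert y (B' - {x})) < d B'"
      using x finite_basis[OF assms(1)] B' unfolding d_def
      by (metis DiffI UnE card_Diff1_less finite_Diff)
    moreover have "I \<subseteq> insert y (B' - {x})"
      using B' x by blast
    ultimately show False
      using min y(2) by (meson leD)
  qed
  with B' that show thesis by blast
qed

text \<open>Augmentation of a set one element short of a basis: the extension of \<open>I\<close>
  inside \<open>I \<union> B\<close> adds a single element, which must come from
  \<open>B\<close>.\<close>

lemma indep_extend_card:
  assumes "matroid M" "indep M I" "B \<in> bases M" "Suc (card I) = card B"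
  obtains z where "z \<in> B - I" "insert z I \<in> bases M"
proof -
  obtain B' where B': "B' \<in> bases M" "I \<subseteq> B'" "B' \<subseteq> I \<union> B"
    using indep_extend[OF assms(1-3)] .
  have fin: "finite B'" "finite I"
    using finite_basis[OF assms(1) B'(1)] B'(2) finite_subset by auto
  have "card B' = card B"
    using card_basis_eq[OF assms(1) B'(1) assms(3)] .
  then have "card (B' - I) = 1"
    using fin B'(2) assms(4) by (simp add: card_Diff_subset)
  then obtain z where z: "B' - I = {z}"
    using card_1_singletonE by blast
  then have "B' = insert z I" "z \<in> B - I"
    using B' by auto
  then show thesis using that B' by simp
qed

text \<open>The set \<open>Y\<close> below is the fundamental circuit of \<open>x\<close> with respect to \<open>B2\<close>, without \<open>x\<close>.\<close>

lemma symmetric_exchange: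
  assumes "matroid M" "B1 \<in> bases M" "B2 \<in> bases M" "x \<in> B1 - B2"
  obtains y where "y \<in> B2 - B1" "insert y (B1 - {x}) \<in> bases M"
    "insert x (B2 - {y}) \<in> bases M"
proof -
  define Y where "Y = {y \<in> B2. insert x (B2 - {y}) \<in> bases M}"
  have fin: "finite B1" "finite B2"
    using finite_basis assms by blast+
  \<comment> \<open>A basis \<open>B'\<close> with
    \<open>insert x Y \<subseteq> B' \<subseteq> insert x B2\<close> has the size of
    \<open>B2\<close>, so it misses exactly one \<open>y\<close> of \<open>B2\<close>. Then
    \<open>B'\<close> is \<open>insert x (B2 - {y})\<close>, which puts \<open>y\<close> in
    \<open>Y\<close> although \<open>B'\<close> contains \<open>Y\<close>.\<close>
  have dep: "\<not> indep M (insert x Y)"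
  proof
    assume "indep M (insert x Y)"
    then obtain B' where B': "B' \<in> bases M" "insert x Y \<subseteq> B'" "B' \<subseteq> insert x Y \<union> B2"
      using indep_extend[OF assms(1) _ assms(3)] by metis
    have sub: "B' \<subseteq> insert x B2"
      using B' by (auto simp: Y_def)
    have card: "card B' = card B2"
      using card_basis_eq[OF assms(1) B'(1) assms(3)] .
    have "\<not> B2 \<subseteq> B'"
      using card B'(2) assms(4) finite_basis[OF assms(1) B'(1)]
      by (metis DiffD2 card_subset_eq insert_subset)
    then obtain y where y: "y \<in> B2" "y \<notin> B'" by blast
    have "B' \<subseteq> insert x (B2 - {y})"
      using sub y by blast
    moreover have "card (insert x (B2 - {y})) = card B2"
      using fin y assms(4) by (intro card_swap) auto
    ultimately have "B' = insert x (B2 - {y})"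
      using card fin by (simp add: card_subset_eq)
    then have "y \<in> Y"
      using B'(1) y by (simp add: Y_def)
    then show False using B'(2) y by blast
  qed
  have "indep M Y"
    unfolding indep_def Y_def using assms(3) by blast
  \<comment> \<open>\<open>B'\<close> cannot contain \<open>x\<close> by \<open>dep\<close>. An
    element that augments \<open>B1 - {x}\<close> from \<open>B'\<close> is therefore in
    \<open>Y\<close> and outside \<open>B1\<close>, so it serves both exchanges.\<close>
  then obtain B' where B': "B' \<in> bases M" "Y \<subseteq> B'" "B' \<subseteq> Y \<union> B1"
    using indep_extend[OF assms(1) _ assms(2)] by metis
  have x: "x \<notin> B'"
    using dep B' unfolding indep_def by blast
  have "indep M (B1 - {x})"
    unfolding indep_def using assms(2) by blast
  moreover have "Suc (card (B1 - {x})) = card B'"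
    using card_basis_eq[OF assms(1,2) B'(1)] fin assms(4) by (metis DiffD1 card_Suc_Diff1)
  ultimately obtain z where z: "z \<in> B' - (B1 - {x})" "insert z (B1 - {x}) \<in> bases M"
    using indep_extend_card[OF assms(1) _ B'(1)] by metis
  then have "z \<in> Y" "z \<notin> B1"
    using B' x by blast+
  then show thesis
    using that z by (auto simp: Y_def)
qed

section \<open>Rank as the largest intersection with a basis\<close>

text \<open>An independent subset of \<open>A\<close> lies in \<open>B \<inter> A\<close> for some
  basis \<open>B\<close>, so the maximum may be taken over these intersections.\<close>

lemma rk_eqI:
  assumes "\<And>B. B \<in> bases M \<Longrightarrow> finite B"
    and "\<And>B. B \<in> bases M \<Longrightarrow> card (B \<inter> A) \<le> r"
    and "B0 \<in> bases M" "card (B0 \<inter> A) = r"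
  shows "rk M A = r"
  unfolding rk_def
proof (rule Max_eqI)
  have le: "card I \<le> r" if "indep M I" "I \<subseteq> A" for I
  proof -
    obtain B where B: "B \<in> bases M" "I \<subseteq> B"
      using \<open>indep M I\<close> by (auto simp: indep_def)
    then have "card I \<le> card (B \<inter> A)"
      using that assms(1) by (intro card_mono) auto
    then show ?thesis using assms(2)[OF B(1)] by simp
  qed
  then show "y \<le> r" if "y \<in> {card I |I. indep M I \<and> I \<subseteq> A}" for y
    using that by blast
  then show "finite {card I |I. indep M I \<and> I \<subseteq> A}"
    by (meson finite_nat_set_iff_bounded_le)
  show "r \<in> {card I |I. indep M I \<and> I \<subseteq> A}"
    using assms(3,4) by (auto simp: indep_def)
qed

lemma matroid_rank_eq:
  assumes "matroid M" "B \<in> bases M"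
  shows "matroid_rank M = card B"
  unfolding matroid_rank_def
proof (rule rk_eqI)
  show "card (B' \<inter> ground M) \<le> card B" if "B' \<in> bases M" for B'
    using that assms card_basis_eq basis_subset_ground by (metis inf.absorb1 le_refl)
  show "card (B \<inter> ground M) = card B"
    using basis_subset_ground[OF assms] by (simp add: inf.absorb1)
qed (use assms finite_basis in blast)+

lemma card_indep_le_rk:
  assumes "matroid M" "indep M I" "I \<subseteq> A"
  shows "card I \<le> rk M A"
  unfolding rk_def
proof (rule Max_ge)
  have "{card I |I. indep M I \<and> I \<subseteq> A} \<subseteq> card ` Pow (ground M)"
    using assms(1) by (auto simp: indep_def dest: basis_subset_ground)
  moreover have "finite (card ` Pow (ground M))"
    using assms(1) by (simp add: matroid_def)
  ultimately show "finite {card I |I. indep M I \<and> I \<subseteq> A}"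
    by (rule finite_subset)
qed (use assms in blast)

lemma card_basis_Int_le_rk:
  assumes "matroid M" "B \<in> bases M"
  shows "card (B \<inter> A) \<le> rk M A"
  using assms by (intro card_indep_le_rk) (auto simp: indep_def)

lemma rk_attained:
  assumes "matroid M"
  obtains B where "B \<in> bases M" "card (B \<inter> A) = rk M A"
proof -
  let ?C = "(\<lambda>B. card (B \<inter> A)) ` bases M"
  have "bases M \<subseteq> Pow (ground M)" "finite (ground M)" "bases M \<noteq> {}"
    using assms by (auto simp: matroid_def)
  then have C: "finite ?C" "?C \<noteq> {}"
    by (auto dest: finite_subset)
  then obtain B where B: "B \<in> bases M" "card (B \<inter> A) = Max ?C"
    using Max_in by (metis (no_types, lifting) imageE)
  then have "rk M A = card (B \<inter> A)"
    using C by (intro rk_eqI finite_basis[OF assms]) auto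
  then show thesis using that B by simp
qed

section \<open>Stressed and tight sets\<close>

text \<open>The consequence of stressedness on which the whole argument rests.\<close>

definition tight :: "'a pre_matroid \<Rightarrow> 'a set \<Rightarrow> bool" where
  "tight M A \<longleftrightarrow> A \<subseteq> ground M \<and> (\<forall>S. S \<subseteq> ground M \<longrightarrow> card S = matroid_rank M \<longrightarrow>
     card (S \<inter> A) = rk M A \<longrightarrow> S \<in> bases M)"

text \<open>Uniformity gives all subsets of \<open>A\<close> of some size \<open>j\<close>. A basis
  of \<open>M\<close> meeting \<open>A\<close> in \<open>rk M A\<close> elements leaves a maximal
  independent set of that size, which identifies \<open>j\<close>.\<close>

lemma bases_restriction:
  assumes "matroid M" "stressed M A"
  shows "bases (restriction M A) = {I. I \<subseteq> A \<and> card I = rk M A}"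
proof -
  obtain j where j: "j \<le> card A" "bases (restriction M A) = {I. I \<subseteq> A \<and> card I = j}"
    using assms(2) by (auto simp: stressed_def is_uniform_def uniform_def restriction_def)
  obtain B where B: "B \<in> bases M" "card (B \<inter> A) = rk M A"
    using rk_attained[OF assms(1)] .
  have "B \<inter> A \<in> bases (restriction M A)"
  proof -
    have "J = B \<inter> A" if J: "indep M J" "B \<inter> A \<subseteq> J" "J \<subseteq> A" for J
    proof -
      have "card J \<le> card (B \<inter> A)"
        using card_indep_le_rk[OF assms(1) J(1,3)] B by simp
      moreover have "finite J"
        using J(1) finite_basis[OF assms(1)] by (auto simp: indep_def dest: finite_subset)
      ultimately show ?thesis
        using J(2) by (metis card_seteq)
    qed
    then show ?thesis
      using B(1) by (auto simp: restriction_def indep_def)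
  qed
  then show ?thesis using j B by auto
qed

text \<open>Uniformity of the contraction lets \<open>S - A\<close> be completed to a basis by some
  \<open>I\<close> inside \<open>A\<close>. Uniformity of the restriction makes
  \<open>S \<inter> A\<close> independent, and \<open>I\<close> can then be replaced by it.\<close>

lemma tight_if_stressed:
  assumes "matroid M" "stressed M A"
  shows "tight M A"
  unfolding tight_def
proof (intro conjI allI impI)
  show "A \<subseteq> ground M"
    using assms(2) by (simp add: stressed_def)
  note AE = this
  have fE: "finite (ground M)"
    using assms(1) by (simp add: matroid_def)
  obtain j where j: "j \<le> card (ground M - A)"
    "bases (contraction M A) = {T. T \<subseteq> ground M - A \<and> card T = j}"
    using assms(2) by (auto simp: stressed_def is_uniform_def uniform_def contraction_def)
  have contr: "bases (contraction M A) =
      {T. T \<subseteq> ground M - A \<and> (\<exists>I. I \<subseteq> A \<and> card I = rk M A \<and> T \<union> I \<in> bases M)}"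
    using bases_restriction[OF assms] by (auto simp: contraction_def)
  obtain B where B: "B \<in> bases M" "card (B \<inter> A) = rk M A"
    using rk_attained[OF assms(1)] .
  have "B - A \<in> bases (contraction M A)"
    unfolding contr using B basis_subset_ground[OF assms(1) B(1)]
    by (auto intro!: exI[of _ "B \<inter> A"] simp: Un_Diff_Int)
  then have "card (B - A) = j"
    using j by simp
  then have rank: "matroid_rank M = j + rk M A"
    using matroid_rank_eq[OF assms(1) B(1)] B(2) card_Diff_subset_Int[of B A]
      finite_basis[OF assms(1) B(1)] card_mono[of B "B \<inter> A"] by simp
  fix S
  assume S: "S \<subseteq> ground M" "card S = matroid_rank M" "card (S \<inter> A) = rk M A"
  have fS: "finite S"
    using S(1) fE finite_subset by blast
  have "card (S - A) = j"
    using S rank card_Diff_subset_Int[of S A] fS by simp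
  then have "S - A \<in> bases (contraction M A)"
    using j S by auto
  then obtain I where I: "I \<subseteq> A" "card I = rk M A" "(S - A) \<union> I \<in> bases M"
    unfolding contr by blast
  have "S \<inter> A \<in> bases (restriction M A)"
    using bases_restriction[OF assms] S by simp
  then have "indep M (S \<inter> A)"
    by (simp add: restriction_def)
  \<comment> \<open>\<open>S \<inter> A\<close> already has full rank in \<open>A\<close>, so
    \<open>B'\<close> can contain no further element of \<open>I\<close> and lies in
    \<open>S\<close>.\<close>
  then obtain B' where B': "B' \<in> bases M" "S \<inter> A \<subseteq> B'" "B' \<subseteq> S \<inter> A \<union> ((S - A) \<union> I)"
    using indep_extend[OF assms(1) _ I(3)] by metis
  have "card (B' \<inter> A) \<le> card (S \<inter> A)"
    using card_basis_Int_le_rk[OF assms(1) B'(1)] S(3) by simp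
  then have "S \<inter> A = B' \<inter> A"
    using B'(2) finite_basis[OF assms(1) B'(1)] by (intro card_seteq) auto
  then have "B' \<subseteq> S"
    using B'(3) I(1) by blast
  moreover have "card B' = card S"
    using matroid_rank_eq[OF assms(1) B'(1)] S(2) by simp
  ultimately show "S \<in> bases M"
    using fS B'(1) by (metis card_subset_eq)
qed

section \<open>Relaxation at a tight set\<close>

text \<open>The cover starts at \<open>rk M A + 1\<close>; tightness supplies the sets with
  equality, so the added family may be taken to start at \<open>rk M A\<close>.\<close>

lemma bases_Rel_tight:
  assumes "matroid M" "tight M A"
  shows "bases (Rel M A) = bases M \<union>
    {S. S \<subseteq> ground M \<and> card S = matroid_rank M \<and> rk M A \<le> card (S \<inter> A)}"
  using assms by (auto simp: Rel_def cover_def tight_def le_eq_less_or_eq)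

lemma ground_Rel [simp]: "ground (Rel M A) = ground M"
  by (simp add: Rel_def)

text \<open>If \<open>B1 - {x}\<close> still has \<open>rk M A\<close> elements in \<open>A\<close>,
  any new element of \<open>B2\<close> gives a set of the family \<open>?G\<close>. Otherwise
  \<open>B1\<close> is a basis of \<open>M\<close>, and the exchange is carried out in
  \<open>M\<close>.\<close>

lemma matroid_Rel:
  assumes "matroid M" "tight M A"
  shows "matroid (Rel M A)"
proof -
  let ?k = "matroid_rank M" and ?r = "rk M A"
  let ?G = "{S. S \<subseteq> ground M \<and> card S = ?k \<and> ?r \<le> card (S \<inter> A)}"
  have bases: "bases (Rel M A) = bases M \<union> ?G"
    using bases_Rel_tight[OF assms] .
  have basis: "B \<subseteq> ground M \<and> card B = ?k" if "B \<in> bases M \<union> ?G" for B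
    using that matroid_rank_eq[OF assms(1)] basis_subset_ground[OF assms(1)] by auto
  have fin: "finite B" if "B \<subseteq> ground M" for B
    using assms(1) that by (auto simp: matroid_def dest: finite_subset)
  have "\<exists>y\<in>B2 - B1. insert y (B1 - {x}) \<in> bases M \<union> ?G"
    if B: "B1 \<in> bases M \<union> ?G" "B2 \<in> bases M \<union> ?G" and x: "x \<in> B1 - B2" for B1 B2 x
  proof (cases "?r \<le> card ((B1 - {x}) \<inter> A)")
    case True
    have fin': "finite B1" "finite B2"
      using basis[OF B(1)] basis[OF B(2)] fin by simp_all
    have "\<not> B2 \<subseteq> B1"
      using x basis[OF B(1)] basis[OF B(2)] card_subset_eq[OF fin'(1), of B2] by auto
    then obtain y where y: "y \<in> B2 - B1" by blast
    have "card (insert y (B1 - {x})) = card B1"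
      using y x fin' by (intro card_swap) auto
    moreover have "card ((B1 - {x}) \<inter> A) \<le> card (insert y (B1 - {x}) \<inter> A)"
      using fin' by (intro card_mono) auto
    moreover have "insert y (B1 - {x}) \<subseteq> ground M"
      using basis[OF B(1)] basis[OF B(2)] y by blast
    ultimately have G: "insert y (B1 - {x}) \<in> ?G"
      using basis[OF B(1)] True by simp
    show ?thesis using G y by (intro bexI[of _ y] UnI2)
  next
    case False
    have fin': "finite B1" "finite B2"
      using basis[OF B(1)] basis[OF B(2)] fin by simp_all
    have "card (B1 \<inter> A) \<le> Suc (card ((B1 - {x}) \<inter> A))"
    proof -
      have "B1 \<inter> A \<subseteq> insert x ((B1 - {x}) \<inter> A)" by blast
      then have "card (B1 \<inter> A) \<le> card (insert x ((B1 - {x}) \<inter> A))"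
        using fin' by (intro card_mono) auto
      also have "\<dots> \<le> Suc (card ((B1 - {x}) \<inter> A))"
        by (rule card_insert_le_m1) auto
      finally show ?thesis .
    qed
    then have le: "card (B1 \<inter> A) \<le> ?r"
      using False by simp
    have B1: "B1 \<in> bases M"
      using B(1)
    proof
      assume "B1 \<in> ?G"
      with le show ?thesis
        using assms(2) by (simp add: tight_def)
    qed
    show ?thesis
    proof (cases "B2 \<in> bases M")
      case True
      obtain y where "y \<in> B2 - B1" "insert y (B1 - {x}) \<in> bases M"
        using matroid_exchange[OF assms(1) B1 True x] .
      then show ?thesis by (intro bexI[of _ y] UnI1)
    next
      case B2: False
      then have "?r \<le> card (B2 \<inter> A)"
        using B(2) by blast
      \<comment> \<open>A basis of \<open>M\<close> is assembled from \<open>I\<close>, inside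
        \<open>B2 \<inter> A\<close>, and a part \<open>T\<close> of \<open>B1 - {x}\<close> outside
        \<open>A\<close>. Augmenting \<open>B1 - {x}\<close> from it can only pick an element of
        \<open>B2\<close>.\<close>
      then obtain I where I: "I \<subseteq> B2 \<inter> A" "card I = ?r"
        by (meson obtain_subset_with_card_n)
      have card1: "card (B1 - {x}) = ?k - 1"
        using x basis[OF B(1)] by simp
      have k0: "?k > 0"
        using x fin' basis[OF B(1)] card_gt_0_iff[of B1] by auto
      \<comment> \<open>Of the \<open>?k - 1\<close> elements of \<open>B1 - {x}\<close>, fewer than
        \<open>?r\<close> lie in \<open>A\<close>.\<close>
      have "?k - ?r \<le> card ((B1 - {x}) - A)"
        using False card1 fin' card_Diff_subset_Int[of "B1 - {x}" A] by simp
      then obtain T where T: "T \<subseteq> (B1 - {x}) - A" "card T = ?k - ?r"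
        by (meson obtain_subset_with_card_n)
      have r: "?r \<le> ?k"
        using rk_attained[OF assms(1), of A] matroid_rank_eq[OF assms(1)] finite_basis[OF assms(1)]
        by (metis card_mono inf_le1)
      have TI: "(T \<union> I) \<inter> A = I"
        using T(1) I(1) by blast
      have "card (T \<union> I) = ?k"
        using T I r fin' by (subst card_Un_disjoint) (auto dest: finite_subset)
      moreover have "T \<union> I \<subseteq> ground M"
        using T(1) I(1) basis[OF B(1)] basis[OF B(2)] by blast
      ultimately have TIb: "T \<union> I \<in> bases M"
        using assms(2) TI I(2) by (simp add: tight_def)
      have "indep M (B1 - {x})"
        using B1 by (auto simp: indep_def)
      moreover have "Suc (card (B1 - {x})) = card (T \<union> I)"
        using \<open>card (T \<union> I) = ?k\<close> card1 k0 by simp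
      ultimately obtain y where y: "y \<in> (T \<union> I) - (B1 - {x})" "insert y (B1 - {x}) \<in> bases M"
        using indep_extend_card[OF assms(1) _ TIb] by metis
      then have "y \<in> B2 - B1"
        using T(1) I(1) x by blast
      with y(2) show ?thesis by (intro bexI[of _ y] UnI1)
    qed
  qed
  then have "\<forall>B1\<in>bases (Rel M A). \<forall>B2\<in>bases (Rel M A). \<forall>x\<in>B1 - B2.
      \<exists>y\<in>B2 - B1. insert y (B1 - {x}) \<in> bases (Rel M A)"
    unfolding bases by simp
  moreover have "\<forall>B\<in>bases (Rel M A). B \<subseteq> ground M"
    unfolding bases using basis_subset_ground[OF assms(1)] by auto
  moreover have "finite (ground M)" "bases (Rel M A) \<noteq> {}"
    using assms(1) unfolding bases by (simp_all add: matroid_def)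
  ultimately show ?thesis
    unfolding matroid_def ground_Rel by blast
qed

text \<open>If every basis met \<open>A\<close> in exactly \<open>rk M A\<close> elements, the independent sets would split along
  \<open>A\<close>, and no circuit could meet both \<open>A\<close> and its complement.\<close>

lemma connected_basis_Int_less:
  assumes "matroid M" "connected_matroid M" "tight M A" "A \<noteq> {}" "A \<noteq> ground M"
  obtains B where "B \<in> bases M" "card (B \<inter> A) < rk M A"
proof -
  have "\<exists>B\<in>bases M. card (B \<inter> A) < rk M A"
  proof (rule ccontr)
    assume "\<not> ?thesis"
    then have eq: "card (B \<inter> A) = rk M A" if "B \<in> bases M" for B
      using card_basis_Int_le_rk[OF assms(1) that] that by (meson le_neq_implies_less)
    obtain e f where ef: "e \<in> A" "f \<in> ground M" "f \<notin> A"
      using assms(3,4,5) by (auto simp: tight_def)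
    then obtain C where C: "circuit M C" "e \<in> C" "f \<in> C"
      using assms(2,3) unfolding connected_matroid_def tight_def by (metis subsetD)
    then have "indep M (C \<inter> A)" "indep M (C - A)"
      using ef unfolding circuit_def by blast+
    then obtain B1 B2 where B: "B1 \<in> bases M" "C \<inter> A \<subseteq> B1" "B2 \<in> bases M" "C - A \<subseteq> B2"
      unfolding indep_def by blast
    have fin: "finite B1" "finite B2"
      using finite_basis[OF assms(1)] B by blast+
    \<comment> \<open>As all bases divide along \<open>A\<close> in the same proportion, this glued
      set has the right sizes to be a basis by tightness; but it contains the circuit
      \<open>C\<close>.\<close>
    define S where "S = (B1 \<inter> A) \<union> (B2 - A)"
    have "S \<inter> A = B1 \<inter> A"
      unfolding S_def by blast
    have "card S = card (B1 \<inter> A) + card (B2 - A)"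
      unfolding S_def using fin by (subst card_Un_disjoint) auto
    also have "\<dots> = card (B2 \<inter> A) + card (B2 - A)"
      using eq B by simp
    also have "\<dots> = card B2"
      using fin by (metis Int_Diff_disjoint Int_Diff_Un card_Un_disjoint finite_Diff finite_Int)
    finally have "card S = matroid_rank M"
      using matroid_rank_eq[OF assms(1) B(3)] by simp
    moreover have "S \<subseteq> ground M"
      using basis_subset_ground[OF assms(1)] B unfolding S_def by blast
    ultimately have "S \<in> bases M"
      using assms(3) eq[OF B(1)] \<open>S \<inter> A = B1 \<inter> A\<close> unfolding tight_def by simp
    moreover have "C \<subseteq> S"
      unfolding S_def using B by blast
    ultimately show False
      using C(1) by (auto simp: circuit_def indep_def)
  qed
  then show thesis using that by blast
qed

section \<open>Cutting a polytope by a hyperplane\<close>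

text \<open>A point \<open>x\<close> strictly below the hyperplane lies on a segment from
  \<open>y\<close> in the hull of \<open>X\<close> to \<open>z\<close> in the hull of
  \<open>Y\<close>. The segment crosses the hyperplane at a point \<open>w\<close>, which
  \<open>cut\<close> places in the hull of \<open>X\<close>, and \<open>x\<close> lies between
  \<open>y\<close> and \<open>w\<close>.\<close>

lemma convex_hull_Un_halfspace:
  fixes X Y :: "'v::euclidean_space set"
  assumes X: "\<And>x. x \<in> X \<Longrightarrow> a \<bullet> x \<le> c" and Y: "\<And>y. y \<in> Y \<Longrightarrow> c \<le> a \<bullet> y"
    and cut: "convex hull (X \<union> Y) \<inter> {x. a \<bullet> x = c} \<subseteq> convex hull X"
  shows "convex hull (X \<union> Y) \<inter> {x. a \<bullet> x \<le> c} = convex hull X"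
proof (intro equalityI subsetI)
  have lo: "a \<bullet> x \<le> c" if "x \<in> convex hull X" for x
    using hull_minimal[of X "{x. a \<bullet> x \<le> c}" convex] X that convex_halfspace_le by blast
  have hi: "c \<le> a \<bullet> x" if "x \<in> convex hull Y" for x
    using hull_minimal[of Y "{x. a \<bullet> x \<ge> c}" convex] Y that convex_halfspace_ge by blast
  show "x \<in> convex hull (X \<union> Y) \<inter> {x. a \<bullet> x \<le> c}" if "x \<in> convex hull X" for x
    using lo[OF that] that hull_mono[of X "X \<union> Y" convex] by blast
  fix x
  assume x: "x \<in> convex hull (X \<union> Y) \<inter> {x. a \<bullet> x \<le> c}"
  show "x \<in> convex hull X"
  proof (cases "a \<bullet> x = c")
    case True
    then show ?thesis using x cut by blast
  next
    case False
    with x have less: "a \<bullet> x < c" by simp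
    show ?thesis
    proof (cases "X = {} \<or> Y = {}")
      case True
      then show ?thesis using x hi less by force
    next
      case False
      have "convex hull (X \<union> Y) = convex hull (convex hull X \<union> convex hull Y)"
        by (rule hull_Un) (auto intro: convex_Inter)
      then obtain u v y z where xyz: "u \<ge> 0" "v \<ge> 0" "u + v = 1" "y \<in> convex hull X"
          "z \<in> convex hull Y" "x = u *\<^sub>R y + v *\<^sub>R z"
        using x False convex_hull_union_two[of "convex hull X" "convex hull Y"]
        by (auto simp: convex_convex_hull)
      have ax: "a \<bullet> x = u * (a \<bullet> y) + v * (a \<bullet> z)"
        using xyz by (simp add: inner_add_right)
      have le: "a \<bullet> y \<le> c" "c \<le> a \<bullet> z"
        using lo hi xyz by blast+
      have ylt: "a \<bullet> y < c"
      proof (rule ccontr)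
        assume "\<not> ?thesis"
        then have "u * c \<le> u * (a \<bullet> y)" "v * c \<le> v * (a \<bullet> z)"
          using le xyz by (simp_all add: mult_left_mono)
        then have "(u + v) * c \<le> a \<bullet> x"
          using ax by (simp add: algebra_simps)
        then show False using less xyz(3) by simp
      qed
      \<comment> \<open>The parameter at which the segment from \<open>y\<close> to \<open>z\<close>
        meets the hyperplane.\<close>
      define t where "t = (c - a \<bullet> y) / (a \<bullet> z - a \<bullet> y)"
      define w where "w = (1 - t) *\<^sub>R y + t *\<^sub>R z"
      have t: "0 < t" "t \<le> 1" "t * (a \<bullet> z - a \<bullet> y) = c - a \<bullet> y"
        using ylt le by (auto simp: t_def divide_simps)
      have "a \<bullet> w = c"
        using t(3) by (simp add: w_def inner_add_right algebra_simps)
      moreover have "w \<in> convex hull (X \<union> Y)"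
        unfolding w_def using xyz t hull_mono[of X "X \<union> Y" convex] hull_mono[of Y "X \<union> Y" convex]
        by (intro convexD) auto
      ultimately have w: "w \<in> convex hull X"
        using cut by blast
      have "v \<le> t"
      proof -
        have u: "u = 1 - v" using xyz by simp
        have "a \<bullet> y + v * (a \<bullet> z - a \<bullet> y) < a \<bullet> y + t * (a \<bullet> z - a \<bullet> y)"
          using less ax t(3) unfolding u by (simp add: algebra_simps)
        then have "v * (a \<bullet> z - a \<bullet> y) < t * (a \<bullet> z - a \<bullet> y)" by simp
        then show ?thesis
          using ylt le by (auto dest: mult_right_less_imp_less)
      qed
      \<comment> \<open>Rescales the position \<open>v\<close> of \<open>x\<close> on the segment
        from \<open>y\<close> to \<open>z\<close> to the shorter segment from \<open>y\<close> to
        \<open>w\<close>.\<close>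
      define s where "s = v / t"
      have "(1 - s) *\<^sub>R y + s *\<^sub>R w = (1 - s * t) *\<^sub>R y + (s * t) *\<^sub>R z"
        by (simp add: w_def algebra_simps)
      moreover have "s * t = v" "1 - s * t = u"
        using t(1) xyz(3) by (simp_all add: s_def)
      ultimately have "x = (1 - s) *\<^sub>R y + s *\<^sub>R w"
        using xyz(6) by simp
      moreover have "0 \<le> s" "s \<le> 1"
        using xyz(2) t(1) \<open>v \<le> t\<close> by (simp_all add: s_def)
      ultimately show ?thesis
        using xyz(4) w by (simp add: convexD)
    qed
  qed
qed

text \<open>The segment from \<open>p\<close> to \<open>q\<close> can be prolonged a little beyond
  \<open>q\<close> inside \<open>P\<close>, and by \<open>loc\<close> inside \<open>C\<close>. Then
  \<open>q\<close> is strictly between two points of \<open>C\<close>, and the face property puts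
  both in \<open>T\<close>.\<close>

lemma subset_face_if_rel_interior_meets:
  fixes P T :: "'v::euclidean_space set"
  assumes "convex P" "q \<in> rel_interior P" "q \<in> T" "T face_of C" "C \<subseteq> P"
    and loc: "\<And>p. p \<in> C \<Longrightarrow> \<exists>m>1. \<forall>e. 1 < e \<and> e \<le> m \<longrightarrow>
      (1 - e) *\<^sub>R p + e *\<^sub>R q \<in> P \<longrightarrow> (1 - e) *\<^sub>R p + e *\<^sub>R q \<in> C"
  shows "C \<subseteq> T"
proof
  fix p
  assume p: "p \<in> C"
  show "p \<in> T"
  proof (cases "p = q")
    case False
    have "p \<in> affine hull P"
      using p assms(5) by (auto intro: hull_inc)
    from bspec[OF convex_rel_interior_if[OF assms(1,2)] this]
    obtain m where m: "m > 1" "\<forall>e. e > 1 \<and> e \<le> m \<longrightarrow> (1 - e) *\<^sub>R p + e *\<^sub>R q \<in> P"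
      by metis
    obtain m' where m': "m' > 1" "\<forall>e. 1 < e \<and> e \<le> m' \<longrightarrow>
        (1 - e) *\<^sub>R p + e *\<^sub>R q \<in> P \<longrightarrow> (1 - e) *\<^sub>R p + e *\<^sub>R q \<in> C"
      using loc[OF p] by metis
    define e where "e = min m m'"
    define p' where "p' = (1 - e) *\<^sub>R p + e *\<^sub>R q"
    have e: "1 < e" "e \<le> m" "e \<le> m'"
      using m(1) m'(1) by (simp_all add: e_def)
    then have p': "p' \<in> C"
      using m(2) m'(2) unfolding p'_def by simp
    define s where "s = 1 / e"
    have s: "0 < s" "s < 1" "s * e = 1"
      using e by (simp_all add: s_def)
    have "(1 - s) *\<^sub>R p + s *\<^sub>R p' = (1 - s * e) *\<^sub>R p + (s * e) *\<^sub>R q"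
      by (simp add: p'_def algebra_simps)
    then have q: "q = (1 - s) *\<^sub>R p + s *\<^sub>R p'"
      using s(3) by simp
    have "(1 - s) *\<^sub>R p + s *\<^sub>R p = p"
      by (simp add: algebra_simps)
    then have "p \<noteq> p'"
      using q False by metis
    then have "q \<in> open_segment p p'"
      unfolding in_segment using q s(1,2) by blast
    then show ?thesis
      using assms(3,4) p p' by (meson face_ofD)
  qed (use assms(3) in simp)
qed

section \<open>The two halves of a polytope, their faces and the internal cells\<close>

locale hyperplane_cut =
  fixes P :: "'v::euclidean_space set" and a :: 'v and c :: real
  assumes P: "polytope P"
    and below: "\<exists>x\<in>P. a \<bullet> x < c" and above: "\<exists>x\<in>P. c < a \<bullet> x"
begin

definition "Lo = P \<inter> {x. a \<bullet> x \<le> c}"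
definition "Hi = P \<inter> {x. c \<le> a \<bullet> x}"
definition "Mid = P \<inter> {x. a \<bullet> x = c}"
text \<open>The cells of the subdivision. The faces of \<open>Mid\<close> and the empty set are
  among them, because \<open>Mid\<close> is a face of each half.\<close>

definition "faces = {Q. Q face_of Lo} \<union> {Q. Q face_of Hi}"

lemma convexP: "convex P"
  using P polytope_imp_convex by blast

lemma convex_Lo: "convex Lo" and convex_Hi: "convex Hi"
  unfolding Lo_def Hi_def
  using convexP convex_halfspace_le convex_halfspace_ge by (blast intro: convex_Int)+

lemma Mid_face_Lo: "Mid face_of Lo"
proof -
  have "Mid = Lo \<inter> {x. a \<bullet> x = c}"
    by (auto simp: Mid_def Lo_def)
  then show ?thesis
    using face_of_Int_supporting_hyperplane_le[OF convex_Lo, of a c] by (simp add: Lo_def)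
qed

lemma Mid_face_Hi: "Mid face_of Hi"
proof -
  have "Mid = Hi \<inter> {x. a \<bullet> x = c}"
    by (auto simp: Mid_def Hi_def)
  then show ?thesis
    using face_of_Int_supporting_hyperplane_ge[OF convex_Hi, of c a] by (simp add: Hi_def)
qed

lemma Lo_Int_Hi: "Lo \<inter> Hi = Mid"
  by (auto simp: Lo_def Hi_def Mid_def)

lemma Union_faces: "\<Union>faces = P"
proof
  show "\<Union>faces \<subseteq> P"
    unfolding faces_def using face_of_imp_subset by (fastforce simp: Lo_def Hi_def)
  have "Lo \<in> faces" "Hi \<in> faces"
    by (simp_all add: faces_def face_of_refl convex_Lo convex_Hi)
  moreover have "P \<subseteq> Lo \<union> Hi"
    by (auto simp: Lo_def Hi_def)
  ultimately show "P \<subseteq> \<Union>faces" by blast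
qed

lemma faces_closed: "Q \<in> faces \<Longrightarrow> F face_of Q \<Longrightarrow> F \<in> faces"
  unfolding faces_def using face_of_trans by blast

text \<open>Faces of the same half meet in a common face. Faces of different halves meet inside
  \<open>Mid\<close>, a face of both halves.\<close>

lemma faces_Int:
  assumes "Q \<in> faces" "R \<in> faces"
  shows "(Q \<inter> R) face_of Q \<and> (Q \<inter> R) face_of R"
proof -
  have same: "(Q \<inter> R) face_of Q \<and> (Q \<inter> R) face_of R" if "Q face_of S" "R face_of S" for S
    using that by (meson face_of_Int face_of_face inf_le1 inf_le2)
  have mixed: "(Q \<inter> R) face_of Q \<and> (Q \<inter> R) face_of R" if "Q face_of Lo" "R face_of Hi" for Q R
    by (rule face_of_Int_subface[OF _ _ that]) (simp_all add: Lo_Int_Hi Mid_face_Lo Mid_face_Hi)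
  show ?thesis
    using assms same mixed[of Q R] mixed[of R Q] unfolding faces_def by (auto simp: Int_commute)
qed

text \<open>A relative interior point is moved towards a point of \<open>P\<close> on the other
  side. Before the endpoint the segment stays in the relative interior, and it crosses the
  hyperplane there.\<close>

lemma ex_rel_interior_Mid: "\<exists>q\<in>rel_interior P. a \<bullet> q = c"
proof -
  have "P \<noteq> {}" using below by blast
  then obtain z where z: "z \<in> rel_interior P"
    using rel_interior_eq_empty[OF convexP] by blast
  have *: "\<exists>q\<in>rel_interior P. a \<bullet> q = c"
    if y: "y \<in> P" and t: "t = (c - a \<bullet> z) / (a \<bullet> y - a \<bullet> z)" "0 < t" "t < 1" "a \<bullet> y \<noteq> a \<bullet> z" for y t
  proof (intro bexI)
    have "(1 - t) *\<^sub>R z + t *\<^sub>R y \<in> open_segment z y"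
      using t by (auto simp: in_segment)
    then show "(1 - t) *\<^sub>R z + t *\<^sub>R y \<in> rel_interior P"
      using rel_interior_closure_convex_segment[OF convexP z, of y] y closure_subset by blast
    have "t * (a \<bullet> y - a \<bullet> z) = c - a \<bullet> z"
      using t by simp
    then show "a \<bullet> ((1 - t) *\<^sub>R z + t *\<^sub>R y) = c"
      by (simp add: inner_add_right algebra_simps)
  qed
  obtain y1 y2 where y: "y1 \<in> P" "a \<bullet> y1 < c" "y2 \<in> P" "c < a \<bullet> y2"
    using below above by blast
  consider "a \<bullet> z = c" | "a \<bullet> z < c" | "c < a \<bullet> z" by linarith
  then show ?thesis
  proof cases
    case 1
    then show ?thesis using z by blast
  next
    case 2
    then show ?thesis
      using y by (intro *[of y2 "(c - a \<bullet> z) / (a \<bullet> y2 - a \<bullet> z)"]) auto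
  next
    case 3
    then show ?thesis
      using y by (intro *[of y1 "(c - a \<bullet> z) / (a \<bullet> y1 - a \<bullet> z)"]) (auto simp: field_simps)
  qed
qed

text \<open>Strictly below the hyperplane the inequality defining \<open>Lo\<close> is slack at
  \<open>q\<close>, so short prolongations inside \<open>P\<close> stay in
  \<open>Lo\<close>.\<close>

lemma Lo_subset_face:
  assumes "Q face_of Lo" "q \<in> Q" "q \<in> rel_interior P" "a \<bullet> q < c"
  shows "Q = Lo"
proof
  show "Q \<subseteq> Lo"
    using assms(1) face_of_imp_subset by blast
  show "Lo \<subseteq> Q"
  proof (rule subset_face_if_rel_interior_meets[OF convexP assms(3,2,1)])
    show "Lo \<subseteq> P" by (simp add: Lo_def)
    fix p
    define d where "d = \<bar>a \<bullet> q - a \<bullet> p\<bar>"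
    \<comment> \<open>\<open>d\<close> bounds the growth of \<open>a \<bullet> x\<close> along the
      line, and \<open>m\<close> is chosen so that this growth uses up at most the slack
      \<open>c - a \<bullet> q\<close>. The summand 1 keeps the denominator positive.\<close>
    define m where "m = 1 + (c - a \<bullet> q) / (1 + d)"
    have d: "d \<ge> 0" "a \<bullet> q - a \<bullet> p \<le> d"
      by (simp_all add: d_def)
    have "a \<bullet> ((1 - e) *\<^sub>R p + e *\<^sub>R q) \<le> c" if e: "1 < e" "e \<le> m" for e
    proof -
      have "a \<bullet> ((1 - e) *\<^sub>R p + e *\<^sub>R q) = a \<bullet> q + (e - 1) * (a \<bullet> q - a \<bullet> p)"
        by (simp add: inner_add_right algebra_simps)
      also have "\<dots> \<le> a \<bullet> q + (e - 1) * (1 + d)"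
        using e d by (intro add_left_mono mult_left_mono) auto
      also have "\<dots> \<le> a \<bullet> q + (m - 1) * (1 + d)"
        using e d by (intro add_left_mono mult_right_mono) auto
      also have "\<dots> = c"
        using d by (simp add: m_def)
      finally show ?thesis .
    qed
    moreover have "m > 1"
      using assms(4) d by (simp add: m_def)
    ultimately show "\<exists>m>1. \<forall>e. 1 < e \<and> e \<le> m \<longrightarrow>
        (1 - e) *\<^sub>R p + e *\<^sub>R q \<in> P \<longrightarrow> (1 - e) *\<^sub>R p + e *\<^sub>R q \<in> Lo"
      unfolding Lo_def by blast
  qed
qed

text \<open>If \<open>q\<close> is on the hyperplane, \<open>Q\<close> contains \<open>Mid\<close>.
  If \<open>Q\<close> also has a point below, the midpoint of that point and \<open>q\<close> is a
  relative interior point of \<open>P\<close> strictly below, and the previous case applies.\<close>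

lemma internal_face_Lo:
  assumes "Q face_of Lo" "q \<in> Q" "q \<in> rel_interior P"
  shows "Q = Lo \<or> Q = Mid"
proof (cases "a \<bullet> q < c")
  case True
  then show ?thesis using Lo_subset_face assms by blast
next
  case False
  have QLo: "Q \<subseteq> Lo"
    using assms(1) face_of_imp_subset by blast
  have q: "a \<bullet> q = c"
    using QLo assms(2) False by (auto simp: Lo_def)
  have Mid: "Mid \<subseteq> Q"
  proof -
    have "q \<in> Q \<inter> Mid"
      using QLo q assms(2) by (auto simp: Lo_def Mid_def)
    moreover have "(Q \<inter> Mid) face_of Mid"
      using assms(1) Mid_face_Lo by (meson face_of_Int face_of_face inf_le2)
    ultimately have "Mid \<subseteq> Q \<inter> Mid"
    proof (rule subset_face_if_rel_interior_meets[OF convexP assms(3)])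
      show "Mid \<subseteq> P" by (simp add: Mid_def)
      fix p
      assume "p \<in> Mid"
      then have "a \<bullet> ((1 - e) *\<^sub>R p + e *\<^sub>R q) = c" for e
        using q by (simp add: Mid_def inner_add_right algebra_simps)
      then show "\<exists>m>1. \<forall>e. 1 < e \<and> e \<le> m \<longrightarrow>
          (1 - e) *\<^sub>R p + e *\<^sub>R q \<in> P \<longrightarrow> (1 - e) *\<^sub>R p + e *\<^sub>R q \<in> Mid"
        \<comment> \<open>The hyperplane contains every affine combination of \<open>p\<close> and
          \<open>q\<close>, so the bound 2 is arbitrary.\<close>
        unfolding Mid_def by (intro exI[of _ 2]) simp
    qed
    then show ?thesis by blast
  qed
  show ?thesis
  proof (cases "Q \<subseteq> Mid")
    case True
    then show ?thesis using Mid by blast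
  next
    case False
    then obtain t where t: "t \<in> Q" "t \<in> P" "a \<bullet> t < c"
      using QLo by (force simp: Lo_def Mid_def)
    define s where "s = midpoint q t"
    have "s \<in> open_segment q t"
      using t q by (auto simp: s_def midpoint_in_open_segment)
    then have "s \<in> rel_interior P"
      using rel_interior_closure_convex_segment[OF convexP assms(3)] t(2) closure_subset by blast
    moreover have "s \<in> Q"
      using assms(2) t(1) face_of_imp_convex[OF assms(1)] \<open>s \<in> open_segment q t\<close>
      by (meson convex_contains_open_segment subsetD)
    moreover have "a \<bullet> s < c"
      using q t by (simp add: s_def midpoint_def inner_add_right)
    ultimately show ?thesis
      using Lo_subset_face[OF assms(1)] by blast
  qed
qed

text \<open>Negating \<open>a\<close> and \<open>c\<close> interchanges the halves.\<close>

lemma internal_face_Hi: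
  assumes "Q face_of Hi" "q \<in> Q" "q \<in> rel_interior P"
  shows "Q = Hi \<or> Q = Mid"
proof -
  interpret reflect: hyperplane_cut P "- a" "- c"
    using P below above by unfold_locales auto
  have "reflect.Lo = Hi" "reflect.Mid = Mid"
    by (simp_all add: reflect.Lo_def reflect.Mid_def Hi_def Mid_def)
  then show ?thesis
    using reflect.internal_face_Lo assms by simp
qed

text \<open>As \<open>P\<close> is closed, a cell outside the relative frontier has a relative
  interior point of \<open>P\<close>. Conversely, one such point on the hyperplane lies in all three
  cells.\<close>

lemma internal_faces_eq: "{Q \<in> faces. \<not> Q \<subseteq> rel_frontier P} = {Lo, Hi, Mid}"
proof -
  have closed: "closed P"
    using P polytope_imp_closed by blast
  have frontier: "rel_frontier P = P - rel_interior P"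
    by (simp add: rel_frontier_def closure_closed[OF closed])
  show ?thesis
  proof (intro equalityI subsetI)
    fix Q
    assume Q: "Q \<in> {Q \<in> faces. \<not> Q \<subseteq> rel_frontier P}"
    then have "Q \<subseteq> P"
      using Union_faces by blast
    then obtain q where "q \<in> Q" "q \<in> rel_interior P"
      using Q unfolding frontier by blast
    then show "Q \<in> {Lo, Hi, Mid}"
      using Q internal_face_Lo internal_face_Hi unfolding faces_def by blast
  next
    fix Q
    assume Q: "Q \<in> {Lo, Hi, Mid}"
    obtain q where q: "q \<in> rel_interior P" "a \<bullet> q = c"
      using ex_rel_interior_Mid by blast
    then have "q \<in> P"
      using rel_interior_subset by blast
    then have "q \<in> Q"
      using Q q by (auto simp: Lo_def Hi_def Mid_def)
    moreover have "Q \<in> faces"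
      using Q Mid_face_Lo by (auto simp: faces_def face_of_refl convex_Lo convex_Hi)
    ultimately show "Q \<in> {Q \<in> faces. \<not> Q \<subseteq> rel_frontier P}"
      using q by (auto simp: frontier)
  qed
qed

lemma distinct_cut: "Lo \<noteq> Hi" "Lo \<noteq> Mid" "Hi \<noteq> Mid"
  using below above by (force simp: Lo_def Hi_def Mid_def set_eq_iff)+

lemma finite_faces:
  assumes "polytope Lo" "polytope Hi"
  shows "finite faces"
  using assms finite_polytope_faces by (auto simp: faces_def)

end

section \<open>The direct sum of two uniform matroids\<close>

text \<open>A set system that depends only on two sizes. It describes both the direct sum of uniform
  matroids and its relaxation, so a single isomorphism lemma handles both.\<close>

definition profile_matroid :: "'a set \<Rightarrow> 'a set \<Rightarrow> (nat \<Rightarrow> nat \<Rightarrow> bool) \<Rightarrow> 'a pre_matroid" where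
  "profile_matroid E A p = Pre_Matroid E {S. S \<subseteq> E \<and> p (card S) (card (S \<inter> A))}"

text \<open>A bijection glued from one on \<open>A\<close> and one on the complement preserves both
  sizes.\<close>

lemma matroid_iso_profile:
  assumes "finite E" "A \<subseteq> E" "finite E'" "A' \<subseteq> E'" "card A = card A'" "card E = card E'"
  shows "matroid_iso (profile_matroid E A p) (profile_matroid E' A' p)"
proof -
  have fin: "finite A" "finite A'"
    using assms finite_subset by blast+
  have "card (E - A) = card (E' - A')"
    using assms fin by (simp add: card_Diff_subset)
  then obtain g where g: "bij_betw g (E - A) (E' - A')"
    using assms(1,3) finite_same_card_bij finite_Diff by metis
  obtain h where h: "bij_betw h A A'"
    using fin assms(5) finite_same_card_bij by metis
  define f where "f x = (if x \<in> A then h x else g x)" for x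
  have fA: "bij_betw f A A'"
    using h by (subst bij_betw_cong[of A f h]) (auto simp: f_def)
  have "bij_betw f (E - A) (E' - A')"
    using g by (subst bij_betw_cong[of "E - A" f g]) (auto simp: f_def)
  then have "bij_betw f (A \<union> (E - A)) (A' \<union> (E' - A'))"
    using fA by (intro bij_betw_combine) auto
  then have f: "bij_betw f E E'"
    using assms(2,4) by (simp add: Un_absorb1)
  have inj: "inj_on f E"
    using f bij_betw_def by blast
  have "B \<in> bases (profile_matroid E A p) \<longleftrightarrow> f ` B \<in> bases (profile_matroid E' A' p)"
    if B: "B \<subseteq> E" for B
  proof -
    have "f ` B \<subseteq> E'"
      using B f bij_betw_imp_surj_on by fastforce
    moreover have "f ` B \<inter> A' = f ` (B \<inter> A)"
      using inj_on_image_Int[OF inj B assms(2)] fA by (simp add: bij_betw_def)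
    moreover have "card (f ` B) = card B" "card (f ` (B \<inter> A)) = card (B \<inter> A)"
      using inj B by (meson card_image inj_on_subset le_infI1)+
    ultimately show ?thesis
      using B by (simp add: profile_matroid_def)
  qed
  then show ?thesis
    unfolding matroid_iso_def using f by (auto simp: profile_matroid_def)
qed

abbreviation split_matroid :: "'a set \<Rightarrow> 'a set \<Rightarrow> nat \<Rightarrow> nat \<Rightarrow> 'a pre_matroid" where
  "split_matroid E A k r \<equiv> profile_matroid E A (\<lambda>i j. i = k \<and> j = r)"

lemma bases_split [simp]:
  "bases (split_matroid E A k r) = {S. S \<subseteq> E \<and> card S = k \<and> card (S \<inter> A) = r}"
  and ground_profile [simp]: "ground (profile_matroid E A p) = E"
  by (simp_all add: profile_matroid_def)

text \<open>A basis of the sum is recovered as \<open>S - A\<close> and \<open>S \<inter> A\<close>;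
  \<open>r \<le> k\<close> keeps the subtraction \<open>k - r\<close> from being truncated.\<close>

lemma direct_sum_uniform:
  assumes "finite E" "A \<subseteq> E" "r \<le> k"
  shows "direct_sum (uniform (k - r) (E - A)) (uniform r A) = split_matroid E A k r"
proof -
  have fin: "finite B" if "B \<subseteq> E" for B
    using assms(1) that finite_subset by blast
  have "{B \<union> C |B C. (B \<subseteq> E - A \<and> card B = k - r) \<and> (C \<subseteq> A \<and> card C = r)} =
      {S. S \<subseteq> E \<and> card S = k \<and> card (S \<inter> A) = r}" (is "?L = ?R")
  proof (intro equalityI subsetI)
    fix S
    assume "S \<in> ?L"
    then obtain B C where BC: "S = B \<union> C" "B \<subseteq> E - A" "card B = k - r" "C \<subseteq> A" "card C = r"
      by blast
    have "finite B" "finite C" "B \<inter> C = {}" "S \<inter> A = C"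
      using BC assms(2) by (auto intro!: fin)
    then show "S \<in> ?R"
      using BC assms(2,3) card_Un_disjoint[of B C] by auto
  next
    fix S
    assume S: "S \<in> ?R"
    have "card (S - A) = k - r"
      using S fin by (simp add: card_Diff_subset_Int)
    then show "S \<in> ?L"
      using S by (intro CollectI exI[of _ "S - A"] exI[of _ "S \<inter> A"]) auto
  qed
  then show ?thesis
    using assms(2) by (simp add: direct_sum_def uniform_def profile_matroid_def Un_absorb2)
qed

lemma matroid_split:
  assumes "finite E" "A \<subseteq> E" "bases (split_matroid E A k r) \<noteq> {}"
  shows "matroid (split_matroid E A k r)"
proof -
  have "\<exists>y\<in>B2 - B1. insert y (B1 - {x}) \<in> bases (split_matroid E A k r)"
    if B: "B1 \<in> bases (split_matroid E A k r)" "B2 \<in> bases (split_matroid E A k r)"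
      and x: "x \<in> B1 - B2" for B1 B2 x
  proof -
    have fin: "finite B1" "finite B2"
      using B assms(1) finite_subset by auto
    \<comment> \<open>\<open>B1\<close> and \<open>B2\<close> have equally many elements on each
      side of \<open>A\<close>, so \<open>x\<close> can be replaced by an element on its own
      side.\<close>
    obtain y where y: "y \<in> B2 - B1" "y \<in> A \<longleftrightarrow> x \<in> A"
    proof (cases "x \<in> A")
      case True
      have "\<not> B2 \<inter> A \<subseteq> B1 \<inter> A"
        using card_subset_eq[of "B1 \<inter> A" "B2 \<inter> A"] B x fin True by auto
      then show thesis using that True by blast
    next
      case False
      have "card (B1 - A) = card (B2 - A)"
        using B fin by (simp add: card_Diff_subset_Int)
      then have "\<not> B2 - A \<subseteq> B1 - A"
        using card_subset_eq[of "B1 - A" "B2 - A"] x fin False by auto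
      then show thesis using that False by blast
    qed
    have "card (insert y (B1 - {x})) = card B1"
      using x y fin by (intro card_swap) auto
    moreover have "card (insert y (B1 - {x}) \<inter> A) = card (B1 \<inter> A)"
    proof (cases "x \<in> A")
      case True
      then have "insert y (B1 - {x}) \<inter> A = insert y (B1 \<inter> A - {x})"
        using y by blast
      moreover have "card (insert y (B1 \<inter> A - {x})) = card (B1 \<inter> A)"
        using True x y fin by (intro card_swap) auto
      ultimately show ?thesis by simp
    next
      case False
      then have "insert y (B1 - {x}) \<inter> A = B1 \<inter> A"
        using y by blast
      then show ?thesis by simp
    qed
    moreover have "insert y (B1 - {x}) \<subseteq> E"
      using B y by auto
    ultimately have "insert y (B1 - {x}) \<in> bases (split_matroid E A k r)"
      using B by simp
    with y(1) show ?thesis by (intro bexI[of _ y])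
  qed
  then show ?thesis
    using assms(1,3) unfolding matroid_def ground_profile by (intro conjI ballI) auto
qed

lemma split_matroid_ranks:
  assumes "finite E" "A \<subseteq> E" "bases (split_matroid E A k r) \<noteq> {}"
  shows "matroid_rank (split_matroid E A k r) = k" "rk (split_matroid E A k r) A = r"
    "tight (split_matroid E A k r) A"
proof -
  note M = matroid_split[OF assms]
  obtain B where B: "B \<in> bases (split_matroid E A k r)"
    using assms(3) by blast
  show k: "matroid_rank (split_matroid E A k r) = k"
    using matroid_rank_eq[OF M B] B by simp
  show r: "rk (split_matroid E A k r) A = r"
  proof (rule rk_eqI[OF _ _ B])
    show "finite B'" if "B' \<in> bases (split_matroid E A k r)" for B'
      using finite_basis[OF M that] .
  qed (use B in auto)
  show "tight (split_matroid E A k r) A"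
    unfolding tight_def k r using assms(2) by simp
qed

lemma Rel_split:
  assumes "finite E" "A \<subseteq> E" "bases (split_matroid E A k r) \<noteq> {}"
  shows "Rel (split_matroid E A k r) A = profile_matroid E A (\<lambda>i j. i = k \<and> r \<le> j)"
  unfolding Rel_def cover_def split_matroid_ranks[OF assms] bases_split ground_profile
  by (auto simp: profile_matroid_def le_eq_less_or_eq)

lemma split_bases_nonempty:
  assumes "finite E" "A \<subseteq> E" "r \<le> card A" "r \<le> k" "k - r \<le> card (E - A)"
  shows "bases (split_matroid E A k r) \<noteq> {}"
proof -
  obtain C where C: "C \<subseteq> A" "card C = r"
    using assms(3) by (meson obtain_subset_with_card_n)
  obtain D where D: "D \<subseteq> E - A" "card D = k - r"
    using assms(5) by (meson obtain_subset_with_card_n)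
  have "finite C" "finite D" "C \<inter> D = {}" "(C \<union> D) \<inter> A = C"
    using C D assms(1,2) by (auto intro: finite_subset)
  then have "C \<union> D \<in> bases (split_matroid E A k r)"
    using C D assms card_Un_disjoint[of C D] by auto
  then show ?thesis by blast
qed

lemma uniform_sum_eq_split:
  assumes "h \<le> n" "r \<le> k"
  shows "uniform_sum r k h n = split_matroid {..<n} {..<h} k r"
proof -
  have "{h..<n} = {..<n} - {..<h}" by auto
  then show ?thesis
    unfolding uniform_sum_def using assms direct_sum_uniform[of "{..<n}" "{..<h}" r k] by simp
qed

section \<open>Base polytopes\<close>

lemma indicator_vec_nth [simp]: "indicator_vec B $ i = (if i \<in> B then 1 else 0)"
  by (simp add: indicator_vec_def axis_def)

lemma inner_indicator_vec: "indicator_vec A \<bullet> x = (\<Sum>i\<in>A. x $ i)"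
proof -
  have "indicator_vec A \<bullet> x = (\<Sum>i\<in>UNIV. if i \<in> A then x $ i else 0)"
    unfolding inner_vec_def by (intro sum.cong) auto
  then show ?thesis by (simp add: sum.If_cases)
qed

lemma inner_indicator_indicator: "indicator_vec A \<bullet> indicator_vec B = real (card (A \<inter> B))"
  by (simp add: inner_indicator_vec sum.If_cases)

lemma indicator_vec_inject [simp]: "indicator_vec A = indicator_vec B \<longleftrightarrow> A = B"
proof
  assume "indicator_vec A = indicator_vec B"
  then have "indicator_vec A $ i = indicator_vec B $ i" for i by simp
  then have "i \<in> A \<longleftrightarrow> i \<in> B" for i
    by (metis indicator_vec_nth zero_neq_one)
  then show "A = B" by blast
qed simp

lemma polytope_base_polytope: "polytope (base_polytope M)"
  by (simp add: base_polytope_def polytope_convex_hull)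

text \<open>A symmetric exchange does not change the midpoint of the two vertices, so the face contains the
  new vertices together with the old ones.\<close>

lemma face_of_base_polytope:
  assumes "matroid M" "F face_of base_polytope M" "F \<noteq> {}"
  shows "\<exists>N. matroid N \<and> ground N = ground M \<and> F = base_polytope N"
proof -
  define N where "N = Pre_Matroid (ground M) {B \<in> bases M. indicator_vec B \<in> F}"
  \<comment> \<open>A face of a convex hull of finitely many points is the hull of some of these
    points.\<close>
  obtain V where V: "V \<subseteq> indicator_vec ` bases M" "F = convex hull V"
    using face_of_convex_hull_subset[of "indicator_vec ` bases M" F] assms(2)
    by (auto simp: base_polytope_def finite_imp_compact)
  have F: "F = base_polytope N"
  proof
    have "V \<subseteq> F"
      unfolding V(2) by (rule hull_subset)
    then have "V \<subseteq> indicator_vec ` bases N"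
      using V(1) by (auto simp: N_def)
    then show "F \<subseteq> base_polytope N"
      unfolding V(2) base_polytope_def by (rule hull_mono)
    show "base_polytope N \<subseteq> F"
      unfolding base_polytope_def using face_of_imp_convex[OF assms(2)]
      by (intro hull_minimal) (auto simp: N_def)
  qed
  have "\<exists>y\<in>B2 - B1. insert y (B1 - {x}) \<in> bases N"
    if B: "B1 \<in> bases N" "B2 \<in> bases N" and x: "x \<in> B1 - B2" for B1 B2 x
  proof -
    have BM: "B1 \<in> bases M" "B2 \<in> bases M" "indicator_vec B1 \<in> F" "indicator_vec B2 \<in> F"
      using B by (auto simp: N_def)
    obtain y where y: "y \<in> B2 - B1" "insert y (B1 - {x}) \<in> bases M" "insert x (B2 - {y}) \<in> bases M"
      using symmetric_exchange[OF assms(1) BM(1,2) x] .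
    let ?C1 = "insert y (B1 - {x})" and ?C2 = "insert x (B2 - {y})"
    have mid: "midpoint (indicator_vec ?C1) (indicator_vec ?C2) =
        midpoint (indicator_vec B1) (indicator_vec B2)"
      using x y(1) by (auto simp: midpoint_def vec_eq_iff)
    \<comment> \<open>The new sets differ, so their midpoint is in an open segment, as the face
      property requires.\<close>
    have "x \<notin> ?C1"
      using x y(1) by auto
    then have "?C1 \<noteq> ?C2" by blast
    then have "midpoint (indicator_vec ?C1) (indicator_vec ?C2)
        \<in> open_segment (indicator_vec ?C1) (indicator_vec ?C2)"
      by simp
    moreover have "midpoint (indicator_vec B1) (indicator_vec B2) \<in> F"
      using BM(3,4) face_of_imp_convex[OF assms(2)]
      by (meson closed_segment_subset midpoint_in_closed_segment subsetD)
    moreover have "indicator_vec ?C1 \<in> base_polytope M" "indicator_vec ?C2 \<in> base_polytope M"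
      unfolding base_polytope_def using y by (auto intro: hull_inc)
    ultimately have "indicator_vec ?C1 \<in> F"
      unfolding mid using face_ofD[OF assms(2)] by blast
    then have "?C1 \<in> bases N"
      using y(2) by (simp add: N_def)
    with y(1) show ?thesis by (intro bexI[of _ y])
  qed
  moreover have "bases N \<noteq> {}"
    using assms(3) F by (auto simp: base_polytope_def)
  ultimately have "matroid N"
    using assms(1) unfolding matroid_def by (intro conjI ballI) (auto simp: N_def)
  moreover have "ground N = ground M"
    by (simp add: N_def)
  ultimately show ?thesis
    using F by blast
qed

section \<open>Slices of the unit cube with integral block sums\<close>

text \<open>A fractional coordinate of a point of the slice forces a second one in the same block, as the
  sum over the block is an integer; shifting weight between the two shows that the point is not
  extreme.\<close>

lemma extreme_point_slice:
  fixes x :: "real ^ 'n"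
  assumes ext: "x extreme_point_of {x \<in> cbox 0 1. \<forall>Z\<in>\<Z>. indicator_vec Z \<bullet> x = c Z}"
    and disj: "pairwise disjnt \<Z>" and cov: "\<Union>\<Z> = UNIV" and int: "\<And>Z. Z \<in> \<Z> \<Longrightarrow> c Z \<in> \<int>"
  shows "x $ i = 0 \<or> x $ i = 1"
proof (rule ccontr)
  let ?D = "{x \<in> cbox 0 1. \<forall>Z\<in>\<Z>. indicator_vec Z \<bullet> x = c Z}"
  assume "\<not> ?thesis"
  moreover have x: "x \<in> ?D"
    using ext by (simp add: extreme_point_of_def)
  then have box: "0 \<le> x $ j" "x $ j \<le> 1" for j
    by (auto simp: mem_box_cart)
  ultimately have i: "0 < x $ i" "x $ i < 1"
    by (simp_all add: less_le)
  have "i \<in> \<Union>\<Z>"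
    by (simp add: cov)
  then obtain Z where Z: "Z \<in> \<Z>" "i \<in> Z"
    by blast
  have "\<exists>j\<in>Z - {i}. x $ j \<noteq> 0 \<and> x $ j \<noteq> 1"
  proof (rule ccontr)
    assume none: "\<not> ?thesis"
    have "(\<Sum>j\<in>Z - {i}. x $ j) \<in> \<int>"
    proof (rule Ints_sum)
      show "x $ j \<in> \<int>" if "j \<in> Z - {i}" for j
        using none that by (cases "x $ j = 0") auto
    qed
    moreover have "c Z = x $ i + (\<Sum>j\<in>Z - {i}. x $ j)"
      using x Z by (auto simp: inner_indicator_vec sum.remove[of Z i])
    moreover from this have "x $ i = c Z - (\<Sum>j\<in>Z - {i}. x $ j)" by simp
    ultimately have "x $ i \<in> \<int>"
      using int[OF Z(1)] by (simp only: Ints_diff)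
    then obtain m where "x $ i = of_int m"
      by (elim Ints_cases)
    then show False using i by auto
  qed
  then obtain j where j: "j \<in> Z" "j \<noteq> i" "0 < x $ j" "x $ j < 1"
    using box by (auto simp: less_le)
  \<comment> \<open>Small enough for both \<open>x + v\<close> and \<open>x - v\<close> to stay in
    the cube.\<close>
  define d where "d = Min {x $ i, 1 - x $ i, x $ j, 1 - x $ j}"
  have d: "d > 0" "d \<le> x $ i" "d \<le> 1 - x $ i" "d \<le> x $ j" "d \<le> 1 - x $ j"
    using i j by (auto simp: d_def)
  define v :: "real ^ 'n" where "v = d *\<^sub>R (axis i 1 - axis j 1)"
  have vnth: "v $ l = (if l = i then d else if l = j then - d else 0)" for l
    using j(2) by (simp add: v_def axis_def)
  have v0: "indicator_vec Z' \<bullet> v = 0" if "Z' \<in> \<Z>" for Z'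
  proof -
    have "i \<in> Z' \<longleftrightarrow> j \<in> Z'"
      using disj that Z j(1) unfolding pairwise_def disjnt_def by blast
    then show ?thesis
      by (simp add: v_def inner_diff_right inner_axis)
  qed
  have "x + v \<in> ?D" "x - v \<in> ?D"
    using x v0 d box by (auto simp: mem_box_cart vnth inner_add_right inner_diff_right)
  moreover have "x \<in> open_segment (x + v) (x - v)"
  proof -
    have "(x + v) $ i \<noteq> (x - v) $ i"
      using vnth[of i] d(1) by simp
    then have "x + v \<noteq> x - v" by metis
    moreover have "midpoint (x + v) (x - v) = x"
      by (simp add: midpoint_def vec_eq_iff)
    ultimately show ?thesis
      by (metis midpoint_in_open_segment)
  qed
  ultimately show False
    using ext unfolding extreme_point_of_def by blast
qed

text \<open>The slice \<open>D\<close> is compact and convex, hence the hull of its extreme points.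
  These are 0/1 vectors, and the block sums identify them as vertices of the split polytope.\<close>

lemma slice_subset_split_polytope:
  fixes x :: "real ^ 'n"
  assumes "A \<subseteq> E" "x \<in> cbox 0 1" "indicator_vec A \<bullet> x = real r"
    "indicator_vec (E - A) \<bullet> x = real s" "indicator_vec (- E) \<bullet> x = 0"
  shows "x \<in> base_polytope (split_matroid E A (r + s) r)"
proof -
  \<comment> \<open>The block \<open>- E\<close> completes a partition of all coordinates; its sum 0
    confines the vertices to subsets of \<open>E\<close>.\<close>
  let ?Z = "{A, E - A, - E}"
  define D where "D = {y \<in> cbox 0 1. \<forall>Z\<in>?Z. indicator_vec Z \<bullet> y = indicator_vec Z \<bullet> x}"
  have D: "D = cbox 0 1 \<inter> (\<Inter>Z\<in>?Z. {y. indicator_vec Z \<bullet> y = indicator_vec Z \<bullet> x})"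
    by (auto simp: D_def)
  have "compact D"
    unfolding D by (intro compact_Int_closed compact_cbox closed_INT ballI closed_hyperplane)
  moreover have "convex D"
    unfolding D by (intro convex_Int convex_INT convex_box(1) convex_hyperplane)
  ultimately have hull: "D = convex hull {v. v extreme_point_of D}"
    by (rule Krein_Milman_Minkowski)
  have "v \<in> indicator_vec ` bases (split_matroid E A (r + s) r)" if v: "v extreme_point_of D" for v
  proof -
    have v01: "v $ i = 0 \<or> v $ i = 1" for i
    proof (rule extreme_point_slice[OF v[unfolded D_def]])
      show "pairwise disjnt ?Z"
        using assms(1) by (auto simp: pairwise_def disjnt_def)
      show "\<Union>?Z = UNIV" by auto
      show "indicator_vec Z \<bullet> x \<in> \<int>" if "Z \<in> ?Z" for Z
        using that assms(3-5) by auto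
    qed
    define S where "S = {i. v $ i = 1}"
    have vS: "v = indicator_vec S"
      using v01 by (auto simp: vec_eq_iff S_def)
    have "v \<in> D"
      using v by (simp add: extreme_point_of_def)
    then have "card (A \<inter> S) = r" "card ((E - A) \<inter> S) = s" "card (- E \<inter> S) = 0"
      using assms(3-5) by (auto simp: D_def vS inner_indicator_indicator)
    moreover from this have "S \<subseteq> E" by auto
    moreover have "card S = card (A \<inter> S) + card ((E - A) \<inter> S)"
    proof -
      have "S = (A \<inter> S) \<union> ((E - A) \<inter> S)"
        using \<open>S \<subseteq> E\<close> by blast
      then show ?thesis
        by (metis (no_types, lifting) Diff_disjoint Int_assoc card_Un_disjoint finite
            inf_bot_left inf_commute inf_left_commute)
    qed
    ultimately show ?thesis
      by (auto simp: vS Int_commute)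
  qed
  then have "D \<subseteq> base_polytope (split_matroid E A (r + s) r)"
    unfolding base_polytope_def by (subst hull) (intro hull_mono, blast)
  then show ?thesis
    using assms(2) by (auto simp: D_def)
qed

section \<open>The subdivision\<close>

text \<open>All vertices lie in the cube, have coordinate sum \<open>k\<close> over the ground set
  and vanish outside it; a sum \<open>r\<close> over \<open>A\<close> leaves \<open>k - r\<close>
  for the rest.\<close>

lemma base_polytope_slice:
  fixes M :: "'a::finite pre_matroid"
  assumes "A \<subseteq> ground M" "\<And>B. B \<in> bases M \<Longrightarrow> B \<subseteq> ground M \<and> card B = k" "r \<le> k"
  shows "base_polytope M \<inter> {x. indicator_vec A \<bullet> x = real r}
    \<subseteq> base_polytope (split_matroid (ground M) A k r)"
proof
  let ?E = "ground M"
  fix x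
  assume x: "x \<in> base_polytope M \<inter> {x. indicator_vec A \<bullet> x = real r}"
  let ?C = "cbox 0 1 \<inter> {x. indicator_vec ?E \<bullet> x = real k} \<inter> {x. indicator_vec (- ?E) \<bullet> x = 0}"
  have "base_polytope M \<subseteq> ?C"
    unfolding base_polytope_def
  proof (rule hull_minimal)
    have "- ?E \<inter> B = {}" "?E \<inter> B = B" if "B \<in> bases M" for B
      using assms(2)[OF that] by auto
    then show "indicator_vec ` bases M \<subseteq> ?C"
      using assms(2) by (auto simp: inner_indicator_indicator mem_box_cart)
    show "convex ?C"
      by (intro convex_Int convex_box(1) convex_hyperplane)
  qed
  then have C: "x \<in> ?C"
    using x by blast
  have "indicator_vec (?E - A) = indicator_vec ?E - indicator_vec A"
    using assms(1) by (auto simp: vec_eq_iff)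
  then have "indicator_vec (?E - A) \<bullet> x = real (k - r)"
    using C x assms(3) by (simp add: inner_diff_left of_nat_diff)
  then have "x \<in> base_polytope (split_matroid ?E A (r + (k - r)) r)"
    using C x assms(1) by (intro slice_subset_split_polytope) auto
  then show "x \<in> base_polytope (split_matroid ?E A k r)"
    using assms(3) by simp
qed

section \<open>The pieces of the polytope of a relaxation\<close>

context
  fixes M :: "'a::finite pre_matroid" and A :: "'a set"
  assumes M: "matroid M" and tight: "tight M A"
begin

private abbreviation (input) "k \<equiv> matroid_rank M"
private abbreviation (input) "r \<equiv> rk M A"
private abbreviation (input) "N \<equiv> split_matroid (ground M) A k r"

private lemma AE: "A \<subseteq> ground M"
  using tight by (simp add: tight_def)

private lemma finE: "finite (ground M)"
  by simp

private lemma basis: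
  assumes "B \<in> bases M"
  shows "B \<subseteq> ground M" "card B = k" "card (B \<inter> A) \<le> r"
  using matroid_rank_eq[OF M assms] basis_subset_ground[OF M assms] card_basis_Int_le_rk[OF M assms]
  by auto

lemma rk_le_rank: "r \<le> k"
proof -
  obtain B where B: "B \<in> bases M" "card (B \<inter> A) = r"
    using rk_attained[OF M] .
  then show ?thesis
    using basis(2)[OF B(1)] card_mono[of B "B \<inter> A"] by simp
qed

lemma split_nonempty: "bases N \<noteq> {}"
proof -
  obtain B where "B \<in> bases M" "card (B \<inter> A) = r"
    using rk_attained[OF M] .
  then have "B \<in> bases N"
    using basis by simp
  then show ?thesis by blast
qed

lemma bases_split_subset: "bases N \<subseteq> bases M"
  using tight by (auto simp: tight_def)

lemma bases_Rel_split: "bases (Rel N A) = {S. S \<subseteq> ground M \<and> card S = k \<and> r \<le> card (S \<inter> A)}"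
  unfolding Rel_split[OF finE AE split_nonempty] by (simp add: profile_matroid_def)

text \<open>Sorts the vertices by the side of the hyperplane; those on the hyperplane, the bases of
  \<open>N\<close>, occur in both families.\<close>

lemma bases_Rel_eq: "bases (Rel M A) = bases M \<union> bases (Rel N A)"
  unfolding bases_Rel_split using bases_Rel_tight[OF M tight] .

lemma bases_split_subset_Rel: "bases N \<subseteq> bases (Rel N A)"
  unfolding bases_Rel_split by auto

lemma polytope_Rel_mid:
  "base_polytope (Rel M A) \<inter> {x. indicator_vec A \<bullet> x = real r} = base_polytope N"
proof
  show "base_polytope (Rel M A) \<inter> {x. indicator_vec A \<bullet> x = real r} \<subseteq> base_polytope N"
  proof -
    have "B \<subseteq> ground (Rel M A) \<and> card B = k" if "B \<in> bases (Rel M A)" for B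
      using that basis(1,2) unfolding bases_Rel_eq bases_Rel_split by auto
    then show ?thesis
      using base_polytope_slice[of A "Rel M A" k r] AE rk_le_rank by simp
  qed
  show "base_polytope N \<subseteq> base_polytope (Rel M A) \<inter> {x. indicator_vec A \<bullet> x = real r}"
    unfolding base_polytope_def
  proof (rule hull_minimal)
    have "indicator_vec ` bases N \<subseteq> convex hull (indicator_vec ` bases (Rel M A))"
      using bases_split_subset unfolding bases_Rel_eq by (auto intro!: hull_inc)
    moreover have "indicator_vec ` bases N \<subseteq> {x. indicator_vec A \<bullet> x = real r}"
      by (auto simp: inner_indicator_indicator Int_commute)
    ultimately show "indicator_vec ` bases N \<subseteq>
        convex hull (indicator_vec ` bases (Rel M A)) \<inter> {x. indicator_vec A \<bullet> x = real r}"
      by (rule Int_greatest)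
  qed (intro convex_Int convex_convex_hull convex_hyperplane)
qed

text \<open>The condition on the cut holds because its vertices, the bases of \<open>N\<close>, are
  bases of \<open>M\<close> by tightness.\<close>

lemma polytope_Rel_lo:
  "base_polytope (Rel M A) \<inter> {x. indicator_vec A \<bullet> x \<le> real r} = base_polytope M"
  unfolding base_polytope_def bases_Rel_eq image_Un
proof (rule convex_hull_Un_halfspace)
  show "indicator_vec A \<bullet> x \<le> real r" if "x \<in> indicator_vec ` bases M" for x
    using that basis(3) by (auto simp: inner_indicator_indicator Int_commute)
  show "real r \<le> indicator_vec A \<bullet> x" if "x \<in> indicator_vec ` bases (Rel N A)" for x
    using that unfolding bases_Rel_split by (auto simp: inner_indicator_indicator Int_commute)
  have "base_polytope N \<subseteq> base_polytope M"
    unfolding base_polytope_def by (intro hull_mono image_mono bases_split_subset)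
  then show "convex hull (indicator_vec ` bases M \<union> indicator_vec ` bases (Rel N A)) \<inter>
      {x. indicator_vec A \<bullet> x = real r} \<subseteq> convex hull (indicator_vec ` bases M)"
    using polytope_Rel_mid unfolding base_polytope_def bases_Rel_eq image_Un by simp
qed

lemma polytope_Rel_hi:
  "base_polytope (Rel M A) \<inter> {x. real r \<le> indicator_vec A \<bullet> x} = base_polytope (Rel N A)"
proof -
  have "convex hull (indicator_vec ` bases (Rel N A) \<union> indicator_vec ` bases M) \<inter>
      {x. - indicator_vec A \<bullet> x \<le> - real r} = convex hull (indicator_vec ` bases (Rel N A))"
  proof (rule convex_hull_Un_halfspace)
    show "- real r \<le> - indicator_vec A \<bullet> x" if "x \<in> indicator_vec ` bases M" for x
      using that basis(3) by (auto simp: inner_indicator_indicator Int_commute)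
    show "- indicator_vec A \<bullet> x \<le> - real r" if "x \<in> indicator_vec ` bases (Rel N A)" for x
      using that unfolding bases_Rel_split by (auto simp: inner_indicator_indicator Int_commute)
    have "base_polytope N \<subseteq> base_polytope (Rel N A)"
      unfolding base_polytope_def by (intro hull_mono image_mono bases_split_subset_Rel)
    then show "convex hull (indicator_vec ` bases (Rel N A) \<union> indicator_vec ` bases M) \<inter>
        {x. - indicator_vec A \<bullet> x = - real r} \<subseteq> convex hull (indicator_vec ` bases (Rel N A))"
      using polytope_Rel_mid unfolding base_polytope_def bases_Rel_eq image_Un
      by (simp add: Un_commute)
  qed
  then show ?thesis
    unfolding base_polytope_def bases_Rel_eq image_Un by (simp add: Un_commute)
qed

lemma matroid_N: "matroid N"
  using matroid_split[OF finE AE split_nonempty] .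

lemma matroid_Rel_N: "matroid (Rel N A)"
  using matroid_Rel[OF matroid_N] split_matroid_ranks(3)[OF finE AE split_nonempty] by blast

lemma split_iso_uniform_sum:
  "matroid_iso N (uniform_sum r k (card A) (card (ground M)))"
  "matroid_iso (Rel N A) (Lambda_matroid r k (card A) (card (ground M)))"
proof -
  let ?h = "card A" and ?n = "card (ground M)"
  have h: "?h \<le> ?n"
    using AE by (simp add: card_mono)
  note U = uniform_sum_eq_split[OF h rk_le_rank]
  show iso: "matroid_iso N (uniform_sum r k ?h ?n)"
    unfolding U using AE h by (intro matroid_iso_profile) auto
  \<comment> \<open>A basis attaining the rank of \<open>A\<close> yields the inequalities that make
    the copy on \<open>{..<?n}\<close> have a basis.\<close>
  obtain B where B: "B \<in> bases M" "card (B \<inter> A) = r"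
    using rk_attained[OF M] .
  have r: "r \<le> ?h"
    using B(2) card_mono[of A "B \<inter> A"] by simp
  have "card (B - A) = k - r"
    using B basis(2)[OF B(1)] by (simp add: card_Diff_subset_Int)
  moreover have "card (B - A) \<le> card (ground M - A)"
    using basis(1)[OF B(1)] by (intro card_mono) auto
  ultimately have kr: "k - r \<le> ?n - ?h"
    using AE by (simp add: card_Diff_subset)
  have "{..<?n} - {..<?h} = {?h..<?n}" by auto
  then have "bases (split_matroid {..<?n} {..<?h} k r) \<noteq> {}"
    using h r kr rk_le_rank by (intro split_bases_nonempty) auto
  then have L: "Lambda_matroid r k ?h ?n = profile_matroid {..<?n} {..<?h} (\<lambda>i j. i = k \<and> r \<le> j)"
    unfolding Lambda_matroid_def U using h by (intro Rel_split) auto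
  show "matroid_iso (Rel N A) (Lambda_matroid r k ?h ?n)"
    unfolding L Rel_split[OF finE AE split_nonempty]
    using AE h by (intro matroid_iso_profile) auto
qed

text \<open>\<open>B0\<close> gives a vertex strictly below the hyperplane and a member of the cover
  one strictly above, so the general result on cut polytopes applies.\<close>

lemma matroid_subdivision_Rel:
  assumes below: "B0 \<in> bases M" "card (B0 \<inter> A) < r" and above: "cover M A \<noteq> {}"
  shows "\<exists>\<S>. matroid_subdivision (Rel M A) \<S> \<and> card (internal_faces (Rel M A) \<S>) = 3 \<and>
    internal_faces (Rel M A) \<S> = {base_polytope M, base_polytope (Rel N A), base_polytope N}"
proof -
  let ?P = "base_polytope (Rel M A)"
  have vertex: "indicator_vec B \<in> ?P" if "B \<in> bases (Rel M A)" for B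
    unfolding base_polytope_def using that by (intro hull_inc) auto
  obtain S where S: "S \<in> cover M A"
    using above by blast
  interpret hyperplane_cut ?P "indicator_vec A" "real r"
  proof
    show "polytope ?P"
      by (rule polytope_base_polytope)
    show "\<exists>x\<in>?P. indicator_vec A \<bullet> x < real r"
      using below by (intro bexI[OF _ vertex[of B0]])
        (auto simp: inner_indicator_indicator Int_commute Rel_def)
    show "\<exists>x\<in>?P. real r < indicator_vec A \<bullet> x"
      using S by (intro bexI[OF _ vertex[of S]])
        (auto simp: inner_indicator_indicator Int_commute Rel_def cover_def)
  qed
  have pieces: "Lo = base_polytope M" "Hi = base_polytope (Rel N A)" "Mid = base_polytope N"
    unfolding Lo_def Hi_def Mid_def by (rule polytope_Rel_lo polytope_Rel_hi polytope_Rel_mid)+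
  have "matroid_subdivision (Rel M A) faces"
    unfolding matroid_subdivision_def
  proof (intro conjI ballI impI allI)
    show "matroid (Rel M A)"
      by (rule matroid_Rel[OF M tight])
    show "finite faces"
      by (rule finite_faces) (simp_all add: pieces polytope_base_polytope)
    show "\<exists>N'. matroid N' \<and> ground N' = ground (Rel M A) \<and> Q = base_polytope N'"
      if Q: "Q \<in> faces" "Q \<noteq> {}" for Q
      using Q face_of_base_polytope[OF M _ Q(2)] face_of_base_polytope[OF matroid_Rel_N _ Q(2)]
      unfolding faces_def pieces by auto
    show "{} \<in> faces"
      by (simp add: faces_def)
  qed (simp_all add: Union_faces faces_closed faces_Int)
  moreover have int: "internal_faces (Rel M A) faces = {Lo, Hi, Mid}"
    unfolding internal_faces_def by (rule internal_faces_eq)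
  moreover have "card {Lo, Hi, Mid} = 3"
    using distinct_cut by simp
  ultimately show ?thesis
    unfolding pieces by auto
qed

end

text \<open>Provides what the connectedness argument needs: elements both inside and outside
  \<open>A\<close>.\<close>

lemma cover_nonempty_proper:
  assumes "matroid M" "cover M A \<noteq> {}"
  shows "A \<noteq> {}" "A \<noteq> ground M"
proof -
  obtain S where S: "S \<subseteq> ground M" "card S = matroid_rank M" "rk M A + 1 \<le> card (S \<inter> A)"
    using assms(2) by (auto simp: cover_def)
  show "A \<noteq> {}"
    using S(3) by auto
  show "A \<noteq> ground M"
    using S by (auto simp: matroid_rank_def inf.absorb1)
qed

lemma matroid_iso_refl: "matroid_iso M M"
  unfolding matroid_iso_def by (intro exI[of _ id]) simp

theorem theorem1p3:
  fixes M :: "'a::finite pre_matroid" and A :: "'a set" and k n r h :: nat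
  assumes "matroid M"
    and "connected_matroid M"
    and "matroid_rank M = k"
    and "card (ground M) = n"
    and "stressed M A"
    and "cover M A \<noteq> {}"
    and "rk M A = r"
    and "card A = h"
  shows "\<exists>\<S>. matroid_subdivision (Rel M A) \<S> \<and>
           card (internal_faces (Rel M A) \<S>) = 3 \<and>
           (\<exists>N1 N2 N3.
              matroid N1 \<and> ground N1 = ground M \<and> matroid_iso N1 M \<and>
              matroid N2 \<and> ground N2 = ground M \<and> matroid_iso N2 (Lambda_matroid r k h n) \<and>
              matroid N3 \<and> ground N3 = ground M \<and> matroid_iso N3 (uniform_sum r k h n) \<and>
              internal_faces (Rel M A) \<S> = {base_polytope N1, base_polytope N2, base_polytope N3})"
proof -
  note tight = tight_if_stressed[OF assms(1,5)]
  let ?N = "split_matroid (ground M) A k r"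
  \<comment> \<open>Connectedness enters here, to give a vertex strictly below the
    hyperplane.\<close>
  obtain B0 where "B0 \<in> bases M" "card (B0 \<inter> A) < rk M A"
    using connected_basis_Int_less[OF assms(1,2) tight cover_nonempty_proper[OF assms(1,6)]] .
  then obtain \<S> where S: "matroid_subdivision (Rel M A) \<S>"
      "card (internal_faces (Rel M A) \<S>) = 3"
      "internal_faces (Rel M A) \<S> = {base_polytope M, base_polytope (Rel ?N A), base_polytope ?N}"
    using matroid_subdivision_Rel[OF assms(1) tight _ _ assms(6)] unfolding assms(3,7) by metis
  have N2: "matroid (Rel ?N A)" "matroid_iso (Rel ?N A) (Lambda_matroid r k h n)"
    and N3: "matroid ?N" "matroid_iso ?N (uniform_sum r k h n)"
    using matroid_Rel_N[OF assms(1) tight] matroid_N[OF assms(1) tight]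
      split_iso_uniform_sum[OF assms(1) tight] unfolding assms(3,4,7,8) by blast+
  show ?thesis
    using S N2 N3 assms(1) matroid_iso_refl[of M]
    by (intro exI[of _ \<S>] conjI exI[of _ M] exI[of _ "Rel ?N A"] exI[of _ ?N]) simp_all
qed

end
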